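(* For each $m\in\left(0,\tfrac{9}{16}\right)$, there exists $\ell\in\left(\tfrac12,\tfrac{25}{32}\right)$ such that $(m,\ell)\in\Lambda_1'$ and $\Theta(m,\ell)=2\pi$. Consequently, for such parameters $(m,\ell)$, the immersion $X_{m,\ell}$ defines an embedded compact spherical Ricci surface in $\mathbb{S}^3$ (that is, $X_{m,\ell}(\mathbb{R}^2)$ is an embedded compact surface in $\mathbb{S}^3$, whose induced metric is a $1$-spherical Ricci metric).
   Context: Here $c=1$ and $\mathbb{S}^3=\{(x,y,z,w)\in\mathbb{R}^4 : x^2+y^2+z^2+w^2=1\}$ with the induced metric. A Riemannian metric on a surface is a $1$-spherical Ricci metric if its Gaussian curvature $K$ satisfies $(K-1)\Delta K-|\nabla K|^2-4K(K-1)^2=0$, with $\nabla$, $\Delta$ the gradient and Laplace–Beltrami operator of the metric. Let $\Lambda_1'=\left\{(m,\ell)\in\mathbb{R}^2 : 0<m<1 \text{ and } \sqrt m<\ell<\frac{m+1}{2}\right\}$. For $(m,\ell)\in\Lambda_1'$ let $$f_{m,\ell}(s)=\sqrt{\ell+\sqrt{\ell^2-m}\,\sin(2s)},\qquad \theta_{m,\ell}(s)=\int_0^s\frac{\sqrt{m+(1-2\ell)f_{m,\ell}(\varsigma)^2}}{f_{m,\ell}(\varsigma)\,(1-f_{m,\ell}(\varsigma)^2)}\,d\varsigma,\qquad s\in\mathbb{R}$$ (both well defined on $\mathbb{R}$, with $0<f_{m,\ell}^2<1$), and set $\Theta(m,\ell)=\theta_{m,\ell}(\pi)$. The immersion $X_{m,\ell}:\mathbb{R}^2\to\mathbb{S}^3$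 is $$X_{m,\ell}(s,t)=\left(\sqrt{1-f_{m,\ell}(s)^2}\cos\theta_{m,\ell}(s),\ \sqrt{1-f_{m,\ell}(s)^2}\sin\theta_{m,\ell}(s),\ f_{m,\ell}(s)\cos t,\ f_{m,\ell}(s)\sin t\right),$$ and its induced metric is $ds^2+f_{m,\ell}(s)^2\,dt^2$. *)

theory Defs
  imports "HOL-Analysis.Analysis"
begin

section \<open>Smooth maps on open subsets of the coordinate plane\<close>

definition pd :: "2 \<Rightarrow> (real^2 \<Rightarrow> 'b::real_normed_vector) \<Rightarrow> real^2 \<Rightarrow> 'b" where
  "pd i u p = frechet_derivative u (at p) (axis i 1)"

text \<open>Only meaningful on open \<open>U\<close>, since the derivatives are taken in the whole plane.\<close>

primrec Ck_on :: "nat \<Rightarrow> (real^2) set \<Rightarrow> (real^2 \<Rightarrow> 'b::real_normed_vector) \<Rightarrow> bool" where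
  "Ck_on 0 U u \<longleftrightarrow> continuous_on U u"
| "Ck_on (Suc k) U u \<longleftrightarrow> (\<forall>p\<in>U. u differentiable (at p)) \<and> (\<forall>i. Ck_on k U (pd i u))"

definition smooth_on :: "(real^2) set \<Rightarrow> (real^2 \<Rightarrow> 'b::real_normed_vector) \<Rightarrow> bool" where
  "smooth_on U u \<longleftrightarrow> (\<forall>k. Ck_on k U u)"

section \<open>Riemannian metrics in local coordinates\<close>

text \<open>A metric on a coordinate domain is its matrix of coefficients,
  \<open>g p $ i $ j = g(\<partial>\<^sub>i, \<partial>\<^sub>j)\<close> at \<open>p\<close>.\<close>

definition riemannian_metric_on :: "(real^2) set \<Rightarrow> (real^2 \<Rightarrow> real^2^2) \<Rightarrow> bool" where
  "riemannian_metric_on U g \<longleftrightarrow> smooth_on U g \<and>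
     (\<forall>p\<in>U. transpose (g p) = g p \<and> (\<forall>v. v \<noteq> 0 \<longrightarrow> v \<bullet> (g p *v v) > 0))"

text \<open>\<open>christoffel g k i j\<close> is the coefficient of \<open>\<partial>\<^sub>k\<close> in the Levi-Civita derivative of
  \<open>\<partial>\<^sub>j\<close> along \<open>\<partial>\<^sub>i\<close>.\<close>

definition christoffel :: "(real^2 \<Rightarrow> real^2^2) \<Rightarrow> 2 \<Rightarrow> 2 \<Rightarrow> 2 \<Rightarrow> real^2 \<Rightarrow> real" where
  "christoffel g k i j p =
     (\<Sum>l\<in>UNIV. matrix_inv (g p) $ k $ l *
        (pd i (\<lambda>q. g q $ j $ l) p + pd j (\<lambda>q. g q $ i $ l) p - pd l (\<lambda>q. g q $ i $ j) p)) / 2"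

text \<open>\<open>riemann_curvature g l k i j\<close> is the coefficient of \<open>\<partial>\<^sub>l\<close> in
  \<open>R(\<partial>\<^sub>i, \<partial>\<^sub>j) \<partial>\<^sub>k\<close>, where \<open>R(V, W) = [\<nabla>\<^sub>V, \<nabla>\<^sub>W] - \<nabla>\<^bsub>[V, W]\<^esub>\<close>.\<close>

definition riemann_curvature :: "(real^2 \<Rightarrow> real^2^2) \<Rightarrow> 2 \<Rightarrow> 2 \<Rightarrow> 2 \<Rightarrow> 2 \<Rightarrow> real^2 \<Rightarrow> real" where
  "riemann_curvature g l k i j p =
     pd i (christoffel g l j k) p - pd j (christoffel g l i k) p +
     (\<Sum>n\<in>UNIV. christoffel g l i n p * christoffel g n j k p
              - christoffel g l j n p * christoffel g n i k p)"

text \<open>\<open>g(R(\<partial>\<^sub>1, \<partial>\<^sub>2) \<partial>\<^sub>2, \<partial>\<^sub>1) / det g\<close>; the round unit sphere has curvature \<open>1\<close>.\<close>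

definition gauss_curvature :: "(real^2 \<Rightarrow> real^2^2) \<Rightarrow> real^2 \<Rightarrow> real" where
  "gauss_curvature g p = (\<Sum>l\<in>UNIV. g p $ 1 $ l * riemann_curvature g l 2 1 2 p) / det (g p)"

definition gradient :: "(real^2 \<Rightarrow> real^2^2) \<Rightarrow> (real^2 \<Rightarrow> real) \<Rightarrow> real^2 \<Rightarrow> real^2" where
  "gradient g u p = matrix_inv (g p) *v (\<chi> j. pd j u p)"

definition metric_norm_sq :: "(real^2 \<Rightarrow> real^2^2) \<Rightarrow> real^2 \<Rightarrow> real^2 \<Rightarrow> real" where
  "metric_norm_sq g p v = v \<bullet> (g p *v v)"

definition laplace_beltrami :: "(real^2 \<Rightarrow> real^2^2) \<Rightarrow> (real^2 \<Rightarrow> real) \<Rightarrow> real^2 \<Rightarrow> real" where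
  "laplace_beltrami g u p =
     (\<Sum>i\<in>UNIV. pd i (\<lambda>q. sqrt (det (g q)) * gradient g u q $ i) p) / sqrt (det (g p))"

definition spherical_ricci_metric_on :: "(real^2) set \<Rightarrow> (real^2 \<Rightarrow> real^2^2) \<Rightarrow> bool" where
  "spherical_ricci_metric_on U g \<longleftrightarrow> riemannian_metric_on U g \<and>
     (let K = gauss_curvature g in
      \<forall>p\<in>U. (K p - 1) * laplace_beltrami g K p - metric_norm_sq g p (gradient g K p)
             - 4 * K p * (K p - 1)\<^sup>2 = 0)"

section \<open>Embedded surfaces and their induced metric\<close>

text \<open>A local parametrization of \<open>S\<close>: a smooth immersion of an open \<open>U\<close> that is a
  homeomorphism onto a relatively open subset of \<open>S\<close>.\<close>

definition local_parametrization ::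
  "'a::euclidean_space set \<Rightarrow> (real^2) set \<Rightarrow> (real^2 \<Rightarrow> 'a) \<Rightarrow> bool" where
  "local_parametrization S U \<phi> \<longleftrightarrow>
     open U \<and> smooth_on U \<phi> \<and> (\<forall>p\<in>U. inj (frechet_derivative \<phi> (at p))) \<and>
     openin (top_of_set S) (\<phi> ` U) \<and> (\<exists>\<psi>. homeomorphism U (\<phi> ` U) \<phi> \<psi>)"

definition embedded_surface :: "'a::euclidean_space set \<Rightarrow> bool" where
  "embedded_surface S \<longleftrightarrow> (\<forall>x\<in>S. \<exists>U \<phi>. local_parametrization S U \<phi> \<and> x \<in> \<phi> ` U)"

definition induced_metric :: "(real^2 \<Rightarrow> 'a::euclidean_space) \<Rightarrow> real^2 \<Rightarrow> real^2^2" where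
  "induced_metric \<phi> p = (\<chi> i j. pd i \<phi> p \<bullet> pd j \<phi> p)"

text \<open>The condition on the induced metric is required in all local parametrizations, so no
  appeal is made to its invariance under changes of coordinates. For \<open>S\<close> contained in the
  unit sphere, the metric induced from the sphere is the one induced from the ambient space.\<close>

definition spherical_ricci_surface :: "'a::euclidean_space set \<Rightarrow> bool" where
  "spherical_ricci_surface S \<longleftrightarrow> embedded_surface S \<and>
     (\<forall>U \<phi>. local_parametrization S U \<phi> \<longrightarrow> spherical_ricci_metric_on U (induced_metric \<phi>))"

section \<open>The two-parameter family of rotational surfaces\<close>

definition Lambda1' :: "(real \<times> real) set" where
  "Lambda1' = {(m, l). 0 < m \<and> m < 1 \<and> sqrt m < l \<and> l < (m + 1) / 2}"

definition f :: "real \<Rightarrow> real \<Rightarrow> real \<Rightarrow> real" where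
  "f m l s = sqrt (l + sqrt (l\<^sup>2 - m) * sin (2 * s))"

text \<open>The interval integral is oriented, so the formula is the intended one for \<open>s < 0\<close> too.\<close>

definition theta :: "real \<Rightarrow> real \<Rightarrow> real \<Rightarrow> real" where
  "theta m l s =
     (LBINT \<sigma>=0..ereal s. sqrt (m + (1 - 2 * l) * (f m l \<sigma>)\<^sup>2) / (f m l \<sigma> * (1 - (f m l \<sigma>)\<^sup>2)))"

definition Theta :: "real \<Rightarrow> real \<Rightarrow> real" where
  "Theta m l = theta m l pi"

definition X :: "real \<Rightarrow> real \<Rightarrow> real^2 \<Rightarrow> real^4" where
  "X m l p =
     (let s = p $ 1; t = p $ 2 in
      vector [sqrt (1 - (f m l s)\<^sup>2) * cos (theta m l s),
              sqrt (1 - (f m l s)\<^sup>2) * sin (theta m l s),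
              f m l s * cos t,
              f m l s * sin t])"

end

theory Submission
  imports Defs
begin

text \<open>
  Write \<open>\<rho> = f\<^sup>2 = l + sqrt (l\<^sup>2 - m) sin 2s\<close>. The first two coordinates of \<open>X\<close> are
  \<open>sqrt (1 - \<rho>) e\<^sup>i\<^sup>\<theta>\<close> and the last two are \<open>sqrt \<rho> e\<^sup>i\<^sup>t\<close>, and \<open>\<theta>' > 0\<close>. So as soon as \<open>\<theta>\<close> gains
  exactly \<open>2 \<pi>\<close> over the period \<open>\<pi>\<close> of \<open>\<rho>\<close>, the radius \<open>sqrt (1 - \<rho>)\<close> is a function of the angle
  \<open>\<theta>\<close> modulo \<open>2 \<pi>\<close>, and the image is a graph over the torus of pairs of angles: it is compact, and
  near each of its points the two angles, read off from the ambient coordinates by an arctangent,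
  are coordinates whose inverse is \<open>X\<close> (\<open>X_chart_inv\<close>, \<open>local_parametrization_X\<close>).

  \<^emph>\<open>Closing the curve.\<close> For fixed \<open>m\<close> the period \<open>\<Theta>(m, l)\<close> is continuous in \<open>l\<close> on
  \<open>[max (sqrt m) (1/2), (m + 1)/2)\<close>, and it takes the value \<open>2 \<pi>\<close> by the intermediate value theorem. At
  \<open>l = sqrt m\<close> the function \<open>\<rho>\<close> is constant and \<open>\<Theta> = \<pi> / sqrt (1 - sqrt m)\<close>, which is below \<open>2 \<pi>\<close>
  exactly when \<open>m < 9/16\<close>. If \<open>m < 1/4\<close> this end of the interval is \<open>l = 1/2\<close> instead; there
  \<open>\<theta>' = sqrt m sqrt \<rho> / (\<rho> (1 - \<rho>))\<close>, and replacing \<open>sqrt \<rho>\<close> by its tangent line at \<open>1/2\<close> leaves an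
  elementary integral with value \<open>sqrt 2 \<pi>\<close>. Towards \<open>l = (m + 1)/2\<close> the maximum of \<open>\<rho>\<close> tends to \<open>1\<close>
  and \<open>\<theta>' \<ge> sqrt m / sqrt (1 - \<rho>)\<close> makes \<open>\<Theta>\<close> diverge logarithmically. The three estimates are
  \<open>Theta_lower_end\<close>, \<open>Theta_at_half\<close> and \<open>Theta_lower_bound\<close>.

  \<^emph>\<open>The Ricci condition.\<close> In the coordinates \<open>(s, t)\<close> the metric is \<open>ds\<^sup>2 + \<rho>(s) dt\<^sup>2\<close>, its curvature
  is \<open>1 - m / \<rho>\<^sup>2\<close>, and the Ricci equation is a computation with \<open>\<rho>'\<^sup>2 = 4 (2 l \<rho> - \<rho>\<^sup>2 - m)\<close> and
  \<open>\<rho>'' = 4 (l - \<rho>)\<close>. The condition is however imposed on every local parametrization \<open>\<phi>\<close>. Locally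
  \<open>\<phi> = X(s, t)\<close> for two functions \<open>s\<close>, \<open>t\<close> of the coordinates (\<open>local_factorization\<close>), so that the
  metric has coefficients \<open>s\<^sub>i s\<^sub>j + \<rho>(s) t\<^sub>i t\<^sub>j\<close>, and it suffices to compute Christoffel symbols, curvature,
  gradient and Laplacian of such a metric in these arbitrary coordinates. This is done in the locale
  \<open>warped_coordinates\<close>; contracting each tensor with \<open>ds\<close> and \<open>dt\<close> reduces it to its expression in
  \<open>(s, t)\<close>. The function \<open>t\<close> is an angle of \<open>\<phi>\<close>, hence smooth. The function \<open>s\<close> is the inverse of
  \<open>\<theta>\<close> at an angle; it is smooth because its derivatives are those of the angle divided by \<open>\<theta>'\<close>, and
  \<open>\<theta>'\<close> depends on \<open>s\<close> only through \<open>\<rho>(s)\<close>, the sum of squares of two coordinates of \<open>\<phi>\<close>.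
\<close>

section \<open>Partial derivatives and differentiability classes\<close>

lemma pd_eqI: "(u has_derivative D) (at p) \<Longrightarrow> pd i u p = D (axis i 1)"
  unfolding pd_def using frechet_derivative_at by metis

lemma has_derivative_pd:
  assumes "u differentiable (at p)"
  shows "(u has_derivative (\<lambda>v. \<Sum>i\<in>UNIV. (v $ i) *\<^sub>R pd i u p)) (at p)"
proof -
  have D: "(u has_derivative frechet_derivative u (at p)) (at p)"
    using assms frechet_derivative_works by blast
  then interpret bounded_linear "frechet_derivative u (at p)"
    by (rule has_derivative_bounded_linear)
  have "frechet_derivative u (at p) v = (\<Sum>i\<in>UNIV. (v $ i) *\<^sub>R pd i u p)" for v
  proof -
    have "v = (\<Sum>i\<in>UNIV. (v $ i) *\<^sub>R axis i 1)"
      by (metis (no_types, lifting) basis_expansion scalar_mult_eq_scaleR sum.cong)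
    then have "frechet_derivative u (at p) v = frechet_derivative u (at p) (\<Sum>i\<in>UNIV. (v $ i) *\<^sub>R axis i 1)"
      by simp
    then show ?thesis unfolding pd_def by (simp add: sum scaleR)
  qed
  then have "frechet_derivative u (at p) = (\<lambda>v. \<Sum>i\<in>UNIV. (v $ i) *\<^sub>R pd i u p)" by auto
  then show ?thesis using D by simp
qed

lemma has_derivative_cong_open:
  assumes "open U" "p \<in> U" "\<And>q. q \<in> U \<Longrightarrow> u q = v q"
  shows "(u has_derivative D) (at p) \<longleftrightarrow> (v has_derivative D) (at p)"
proof
  show "(v has_derivative D) (at p)" if "(u has_derivative D) (at p)"
    by (rule has_derivative_transform_within_open[OF that assms(1,2)]) (rule assms(3))
  show "(u has_derivative D) (at p)" if "(v has_derivative D) (at p)"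
    by (rule has_derivative_transform_within_open[OF that assms(1,2)]) (rule assms(3)[symmetric])
qed

lemma pd_cong:
  assumes "open U" "p \<in> U" "\<And>q. q \<in> U \<Longrightarrow> u q = v q"
  shows "pd i u p = pd i v p"
  using has_derivative_cong_open[of U p u v, OF assms(1,2)] assms(3)
  unfolding pd_def frechet_derivative_def by simp

lemma differentiable_cong_open:
  assumes "open U" "p \<in> U" "\<And>q. q \<in> U \<Longrightarrow> u q = v q" "u differentiable (at p)"
  shows "v differentiable (at p)"
  using has_derivative_cong_open[of U p u v, OF assms(1,2)] assms(3,4)
  unfolding differentiable_def by simp

lemma Ck_on_cong:
  assumes "open U" "\<And>q. q \<in> U \<Longrightarrow> u q = v q" "Ck_on k U u"
  shows "Ck_on k U v"
  using assms(2,3)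
proof (induction k arbitrary: u v)
  case 0
  then have "continuous_on U u" by simp
  moreover have "continuous_on U u = continuous_on U v"
    by (rule continuous_on_cong[OF refl]) (rule 0(1))
  ultimately show ?case by simp
next
  case (Suc k)
  from Suc.prems(2) have u: "\<And>p. p \<in> U \<Longrightarrow> u differentiable (at p)" "\<And>i. Ck_on k U (pd i u)"
    by simp_all
  have "Ck_on k U (pd i v)" for i
  proof (rule Suc.IH[of "pd i u"])
    show "pd i u q = pd i v q" if "q \<in> U" for q
      by (rule pd_cong[OF assms(1) that]) (rule Suc.prems(1))
  qed (rule u(2))
  moreover have "v differentiable (at p)" if "p \<in> U" for p
    by (rule differentiable_cong_open[OF assms(1) that _ u(1)[OF that]]) (rule Suc.prems(1))
  ultimately show ?case by simp
qed

lemma Ck_on_subset: "Ck_on k U u \<Longrightarrow> V \<subseteq> U \<Longrightarrow> Ck_on k V u"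
proof (induction k arbitrary: u)
  case 0
  then show ?case by (simp add: continuous_on_subset[of U])
next
  case (Suc k)
  from Suc.prems(1) Suc.IH[OF _ Suc.prems(2)] Suc.prems(2) show ?case by (simp add: subset_iff)
qed

lemma Ck_on_SucD: "Ck_on (Suc k) U u \<Longrightarrow> Ck_on k U u"
proof (induction k arbitrary: u)
  case 0
  then have "\<And>p. p \<in> U \<Longrightarrow> u differentiable (at p)" by simp
  then show ?case
    by (simp add: continuous_at_imp_continuous_on differentiable_imp_continuous_within)
next
  case (Suc k)
  then have "\<And>p. p \<in> U \<Longrightarrow> u differentiable (at p)" "\<And>i. Ck_on (Suc k) U (pd i u)"
    using Ck_on.simps(2)[of "Suc k" U u] by blast+
  then show ?case using Suc.IH Ck_on.simps(2)[of k U u] by blast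
qed

lemma Ck_on_const [simp]: "Ck_on k U (\<lambda>p. c)"
proof (induction k arbitrary: c)
  case (Suc k)
  have "pd i (\<lambda>p. c) = (\<lambda>p. 0)" for i by (auto intro!: pd_eqI derivative_eq_intros)
  then show ?case using Suc by auto
qed auto

lemma Ck_on_add:
  assumes U: "open U"
  shows "Ck_on k U u \<Longrightarrow> Ck_on k U v \<Longrightarrow> Ck_on k U (\<lambda>p. u p + v p)"
proof (induction k arbitrary: u v)
  case (Suc k)
  have "pd i (\<lambda>p. u p + v p) p = pd i u p + pd i v p" if "p \<in> U" for p i
  proof -
    have "u differentiable (at p)" "v differentiable (at p)" using Suc.prems that by auto
    then have "((\<lambda>p. u p + v p) has_derivative
        (\<lambda>h. frechet_derivative u (at p) h + frechet_derivative v (at p) h)) (at p)"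
      unfolding frechet_derivative_works by (rule has_derivative_add)
    from pd_eqI[OF this] show ?thesis unfolding pd_def .
  qed
  then have "Ck_on k U (pd i (\<lambda>p. u p + v p))" for i
    using Ck_on_cong[OF U, of "\<lambda>p. pd i u p + pd i v p"] Suc by simp
  then show ?case using Suc.prems by simp
qed (simp add: continuous_on_add)

lemma pd_bilinear:
  assumes B: "bounded_bilinear B" and "u differentiable (at p)" "v differentiable (at p)"
  shows "pd i (\<lambda>p. B (u p) (v p)) p = B (u p) (pd i v p) + B (pd i u p) (v p)"
    "(\<lambda>p. B (u p) (v p)) differentiable (at p)"
proof -
  have "((\<lambda>p. B (u p) (v p)) has_derivative
      (\<lambda>h. B (u p) (frechet_derivative v (at p) h) + B (frechet_derivative u (at p) h) (v p))) (at p)"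
    by (intro bounded_bilinear.FDERIV[OF B]) (use assms frechet_derivative_works in auto)
  then show "pd i (\<lambda>p. B (u p) (v p)) p = B (u p) (pd i v p) + B (pd i u p) (v p)"
    "(\<lambda>p. B (u p) (v p)) differentiable (at p)"
    by (simp add: pd_eqI, simp add: pd_def, auto simp: differentiable_def)
qed

lemma Ck_on_bilinear:
  assumes U: "open U" and B: "bounded_bilinear B"
  shows "Ck_on k U u \<Longrightarrow> Ck_on k U v \<Longrightarrow> Ck_on k U (\<lambda>p. B (u p) (v p))"
proof (induction k arbitrary: u v)
  case 0
  then show ?case by (simp add: bounded_bilinear.continuous_on[OF B])
next
  case (Suc k)
  have d: "u differentiable (at p)" "v differentiable (at p)" if "p \<in> U" for p
    using Suc.prems that by simp_all
  have "Ck_on k U (pd i (\<lambda>p. B (u p) (v p)))" for i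
  proof (rule Ck_on_cong[OF U])
    have "Ck_on k U (pd i u)" "Ck_on k U (pd i v)" using Suc.prems by simp_all
    then show "Ck_on k U (\<lambda>p. B (u p) (pd i v p) + B (pd i u p) (v p))"
      by (rule Ck_on_add[OF U Suc.IH[OF Ck_on_SucD[OF Suc.prems(1)]] Suc.IH[OF _ Ck_on_SucD[OF Suc.prems(2)]], rotated])
    show "B (u q) (pd i v q) + B (pd i u q) (v q) = pd i (\<lambda>p. B (u p) (v p)) q" if "q \<in> U" for q
      using pd_bilinear(1)[OF B d[OF that]] by simp
  qed
  then show ?case using pd_bilinear(2)[OF B d] by simp
qed

lemma Ck_on_linear:
  assumes U: "open U" and L: "bounded_linear L"
  shows "Ck_on k U u \<Longrightarrow> Ck_on k U (\<lambda>p. L (u p))"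
proof (induction k arbitrary: u)
  case 0
  then show ?case by (auto intro: bounded_linear.continuous_on[OF L])
next
  case (Suc k)
  have *: "((\<lambda>p. L (u p)) has_derivative (\<lambda>h. L (frechet_derivative u (at p) h))) (at p)" if "p \<in> U" for p
    using Suc.prems that frechet_derivative_works by (intro bounded_linear.has_derivative[OF L]) auto
  have "Ck_on k U (pd i (\<lambda>p. L (u p)))" for i
  proof (rule Ck_on_cong[OF U])
    show "Ck_on k U (\<lambda>p. L (pd i u p))" using Suc by auto
    show "L (pd i u p) = pd i (\<lambda>p. L (u p)) p" if "p \<in> U" for p
      using *[OF that] by (simp add: pd_eqI) (simp add: pd_def)
  qed
  then show ?case using * by (auto simp: differentiable_def)
qed

lemma Ck_on_mult: "open U \<Longrightarrow> Ck_on k U u \<Longrightarrow> Ck_on k U v \<Longrightarrow> Ck_on k U (\<lambda>p. u p * v p :: real)"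
  by (rule Ck_on_bilinear[OF _ bounded_bilinear_mult])

lemma Ck_on_minus: "open U \<Longrightarrow> Ck_on k U u \<Longrightarrow> Ck_on k U (\<lambda>p. - u p)"
  by (rule Ck_on_linear[OF _ bounded_linear_minus[OF bounded_linear_ident]])

lemma Ck_on_diff: "open U \<Longrightarrow> Ck_on k U u \<Longrightarrow> Ck_on k U v \<Longrightarrow> Ck_on k U (\<lambda>p. u p - v p)"
  using Ck_on_add[of U k u "\<lambda>p. - v p"] Ck_on_minus[of U k v] by simp

text \<open>The derivative of \<open>h\<close> along \<open>v\<close> enters as a function \<open>h'\<close> on the plane, and only its order of
  differentiability is assumed. This makes the lemma the induction step for each elementary
  function: \<open>h'\<close> is built from \<open>h\<close> and \<open>v\<close>, whose order is known from the previous step.\<close>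

lemma Ck_on_chain:
  fixes v :: "real^2 \<Rightarrow> real"
  assumes U: "open U" and v: "Ck_on (Suc k) U v"
    and h: "\<And>p. p \<in> U \<Longrightarrow> (h has_real_derivative h' p) (at (v p))"
    and h': "Ck_on k U h'"
  shows "Ck_on (Suc k) U (\<lambda>p. h (v p))"
proof -
  have *: "((\<lambda>p. h (v p)) has_derivative (\<lambda>w. h' p * frechet_derivative v (at p) w)) (at p)" if "p \<in> U" for p
  proof -
    have "(v has_derivative frechet_derivative v (at p)) (at p)"
      using v that frechet_derivative_works[of v "at p"] by auto
    from DERIV_compose_FDERIV[where f=h and g=v, OF h[OF that] this] show ?thesis
      by (simp add: mult.commute)
  qed
  have "Ck_on k U (pd i (\<lambda>p. h (v p)))" for i
  proof (rule Ck_on_cong[OF U])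
    show "Ck_on k U (\<lambda>p. h' p * pd i v p)" using v h' by (intro Ck_on_mult U) auto
    show "h' p * pd i v p = pd i (\<lambda>p. h (v p)) p" if "p \<in> U" for p
      using *[OF that] by (simp add: pd_eqI) (simp add: pd_def)
  qed
  then show ?thesis using * by (auto simp: differentiable_def)
qed

lemma Ck_on_inverse:
  fixes v :: "real^2 \<Rightarrow> real"
  assumes U: "open U" and nz: "\<And>p. p \<in> U \<Longrightarrow> v p \<noteq> 0"
  shows "Ck_on k U v \<Longrightarrow> Ck_on k U (\<lambda>p. inverse (v p))"
proof (induction k)
  case 0
  then show ?case using nz by (auto intro: continuous_intros)
next
  case (Suc k)
  have "Ck_on k U (\<lambda>p. - (inverse (v p) * inverse (v p)))"
    using Suc Ck_on_SucD by (intro Ck_on_minus Ck_on_mult U) blast+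
  moreover have "(inverse has_real_derivative - (inverse (v p) * inverse (v p))) (at (v p))" if "p \<in> U" for p
    using DERIV_inverse[OF nz[OF that], of UNIV] by (simp add: power2_eq_square)
  ultimately show ?case
    by (intro Ck_on_chain[OF U Suc.prems, where h=inverse]) auto
qed

lemma Ck_on_sqrt:
  fixes v :: "real^2 \<Rightarrow> real"
  assumes U: "open U" and pos: "\<And>p. p \<in> U \<Longrightarrow> 0 < v p"
  shows "Ck_on k U v \<Longrightarrow> Ck_on k U (\<lambda>p. sqrt (v p))"
proof (induction k)
  case 0
  then show ?case by (auto intro: continuous_intros)
next
  case (Suc k)
  have "Ck_on k U (\<lambda>p. inverse (sqrt (v p)) * (1/2))"
    using Suc Ck_on_SucD by (intro Ck_on_mult Ck_on_inverse Ck_on_const U) (auto dest: pos)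
  moreover have "(sqrt has_real_derivative inverse (sqrt (v p)) * (1/2)) (at (v p))" if "p \<in> U" for p
    using DERIV_real_sqrt[OF pos[OF that]] by simp
  ultimately show ?case
    by (intro Ck_on_chain[OF U Suc.prems, where h=sqrt]) auto
qed

lemma Ck_on_sin_cos:
  fixes v :: "real^2 \<Rightarrow> real"
  assumes U: "open U"
  shows "Ck_on k U v \<Longrightarrow> Ck_on k U (\<lambda>p. sin (v p)) \<and> Ck_on k U (\<lambda>p. cos (v p))"
proof (induction k)
  case 0
  then show ?case by (auto intro: continuous_intros)
next
  case (Suc k)
  then have IH: "Ck_on k U (\<lambda>p. sin (v p))" "Ck_on k U (\<lambda>p. cos (v p))" using Ck_on_SucD by blast+
  show ?case
  proof
    show "Ck_on (Suc k) U (\<lambda>p. sin (v p))"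
      by (rule Ck_on_chain[OF U Suc.prems, where h=sin, OF DERIV_sin IH(2)])
    show "Ck_on (Suc k) U (\<lambda>p. cos (v p))"
      by (rule Ck_on_chain[OF U Suc.prems, where h=cos, OF DERIV_cos]) (rule Ck_on_minus[OF U IH(1)])
  qed
qed

lemma has_derivative_vec_nth_I:
  fixes u :: "'a::real_normed_vector \<Rightarrow> 'b::euclidean_space^'n"
  assumes "\<And>j. ((\<lambda>p. u p $ j) has_derivative (\<lambda>h. D h $ j)) (at p)"
  shows "(u has_derivative D) (at p)"
proof (subst has_derivative_componentwise_within, intro ballI)
  fix b :: "'b^'n" assume "b \<in> Basis"
  then obtain j c where b: "b = axis j c" unfolding Basis_vec_def by blast
  show "((\<lambda>x. u x \<bullet> b) has_derivative (\<lambda>x. D x \<bullet> b)) (at p)"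
    unfolding b inner_axis by (rule has_derivative_inner_left[OF assms])
qed

lemma Ck_on_vec:
  fixes u :: "_ \<Rightarrow> 'b::euclidean_space^'n"
  assumes U: "open U" and "\<And>j. Ck_on k U (\<lambda>p. u p $ j)"
  shows "Ck_on k U u"
  using assms(2)
proof (induction k arbitrary: u)
  case 0
  then have "continuous_on U (\<lambda>p. \<chi> j. u p $ j)" by (intro continuous_on_vec_lambda) simp
  then show ?case by simp
next
  case (Suc k)
  have *: "(u has_derivative (\<lambda>h. \<chi> j. frechet_derivative (\<lambda>p. u p $ j) (at p) h)) (at p)" if "p \<in> U" for p
  proof (rule has_derivative_vec_nth_I)
    show "((\<lambda>p. u p $ j) has_derivative (\<lambda>h. (\<chi> j. frechet_derivative (\<lambda>p. u p $ j) (at p) h) $ j)) (at p)" for j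
      using Suc.prems[of j] that frechet_derivative_works[of "\<lambda>p. u p $ j" "at p"] by simp
  qed
  have "Ck_on k U (pd i u)" for i
  proof (rule Ck_on_cong[OF U])
    show "Ck_on k U (\<lambda>p. \<chi> j. pd i (\<lambda>p. u p $ j) p)"
      using Suc.prems by (intro Suc.IH) auto
    show "(\<chi> j. pd i (\<lambda>p. u p $ j) p) = pd i u p" if "p \<in> U" for p
      using *[OF that] by (simp add: pd_eqI) (simp add: pd_def)
  qed
  then show ?case using * by (auto simp: differentiable_def)
qed

text \<open>This is how functions given by their differentials (antiderivatives, inverse functions) are
  recognized as smooth: no formula for the function itself is needed.\<close>

lemma smooth_on_I:
  assumes "\<And>p. p \<in> U \<Longrightarrow> u differentiable (at p)" "\<And>i. smooth_on U (pd i u)"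
  shows "smooth_on U u"
proof -
  have "Ck_on (Suc k) U u" for k using assms by (auto simp: smooth_on_def)
  then show ?thesis unfolding smooth_on_def using Ck_on_SucD by blast
qed

lemma smooth_on_pd: "smooth_on U u \<Longrightarrow> smooth_on U (pd i u)"
  unfolding smooth_on_def by (metis Ck_on.simps(2))

lemma smooth_on_differentiable: "smooth_on U u \<Longrightarrow> p \<in> U \<Longrightarrow> u differentiable (at p)"
  unfolding smooth_on_def by (metis Ck_on.simps(2))

lemma pd_mult:
  fixes u v :: "real^2 \<Rightarrow> real"
  assumes "u differentiable (at p)" "v differentiable (at p)"
  shows "pd i (\<lambda>p. u p * v p) p = u p * pd i v p + pd i u p * v p"
  using pd_bilinear(1)[OF bounded_bilinear_mult assms] .

lemma pd_add:
  fixes u v :: "real^2 \<Rightarrow> real"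
  assumes "u differentiable (at p)" "v differentiable (at p)"
  shows "pd i (\<lambda>p. u p + v p) p = pd i u p + pd i v p"
proof -
  have "((\<lambda>p. u p + v p) has_derivative
      (\<lambda>h. frechet_derivative u (at p) h + frechet_derivative v (at p) h)) (at p)"
    using assms unfolding frechet_derivative_works by (rule has_derivative_add)
  from pd_eqI[OF this] show ?thesis unfolding pd_def .
qed

lemma pd_comp:
  fixes v :: "real^2 \<Rightarrow> real"
  assumes "(h has_real_derivative h') (at (v p))" "v differentiable (at p)"
  shows "pd i (\<lambda>p. h (v p)) p = h' * pd i v p" "(\<lambda>p. h (v p)) differentiable (at p)"
proof -
  have "(v has_derivative frechet_derivative v (at p)) (at p)"
    using assms(2) frechet_derivative_works by blast
  note * = DERIV_compose_FDERIV[where f=h and g=v, OF assms(1) this]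
  show "pd i (\<lambda>p. h (v p)) p = h' * pd i v p" using pd_eqI[OF *] by (simp add: pd_def mult.commute)
  show "(\<lambda>p. h (v p)) differentiable (at p)" using * by (auto simp: differentiable_def)
qed

lemma Ck_on_arctan:
  fixes v :: "real^2 \<Rightarrow> real"
  assumes U: "open U" and v: "Ck_on k U v"
  shows "Ck_on k U (\<lambda>p. arctan (v p))"
proof (cases k)
  case 0
  then show ?thesis using v by (auto intro: continuous_intros)
next
  case (Suc n)
  have nz: "1 + v p * v p \<noteq> 0" for p by (smt (verit) zero_le_square)
  have v': "Ck_on (Suc n) U v" using v Suc by simp
  have "Ck_on n U (\<lambda>p. inverse (1 + v p * v p))"
    by (intro Ck_on_inverse[OF U nz] Ck_on_add[OF U Ck_on_const] Ck_on_mult[OF U] Ck_on_SucD[OF v'])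
  then show ?thesis unfolding Suc
    by (intro Ck_on_chain[OF U v', where h=arctan])
      (simp_all add: DERIV_arctan[unfolded power2_eq_square])
qed

lemma Ck_on_id: "Ck_on k U (\<lambda>p. p)"
proof (cases k)
  case (Suc n)
  have "pd i (\<lambda>p. p) = (\<lambda>p. axis i 1)" for i by (auto intro!: pd_eqI)
  then show ?thesis using Suc by simp
qed simp

lemma Ck_on_coordinate: "open U \<Longrightarrow> Ck_on k U (\<lambda>p. p $ i)"
  by (rule Ck_on_linear[OF _ bounded_linear_vec_nth Ck_on_id])

lemma smooth_on_subset: "smooth_on U u \<Longrightarrow> V \<subseteq> U \<Longrightarrow> smooth_on V u"
  unfolding smooth_on_def using Ck_on_subset by blast

lemma smooth_on_cong: "open U \<Longrightarrow> (\<And>q. q \<in> U \<Longrightarrow> u q = v q) \<Longrightarrow> smooth_on U u \<Longrightarrow> smooth_on U v"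
  unfolding smooth_on_def using Ck_on_cong by blast

lemma smooth_on_component:
  "open U \<Longrightarrow> smooth_on U u \<Longrightarrow> smooth_on U (\<lambda>p. (u p :: real^'n) $ j)"
  unfolding smooth_on_def using Ck_on_linear[OF _ bounded_linear_vec_nth] by blast

section \<open>Symmetry of second derivatives\<close>

lemma pd_line:
  fixes u :: "real^2 \<Rightarrow> real"
  assumes "u differentiable (at (q + a *\<^sub>R axis i 1))"
  shows "((\<lambda>a. u (q + a *\<^sub>R axis i 1)) has_real_derivative pd i u (q + a *\<^sub>R axis i 1)) (at a)"
proof -
  have "(u has_derivative frechet_derivative u (at (q + a *\<^sub>R axis i 1))) (at (q + a *\<^sub>R axis i 1))"
    using assms frechet_derivative_works by blast
  moreover have "((\<lambda>a. q + a *\<^sub>R axis i 1) has_derivative (\<lambda>h. h *\<^sub>R axis i 1)) (at a)"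
    by (auto intro!: derivative_eq_intros)
  ultimately have "((\<lambda>a. u (q + a *\<^sub>R axis i 1)) has_derivative
      (\<lambda>h. frechet_derivative u (at (q + a *\<^sub>R axis i 1)) (h *\<^sub>R axis i 1))) (at a)"
    by (rule has_derivative_compose[rotated])
  moreover have "frechet_derivative u (at (q + a *\<^sub>R axis i 1)) (h *\<^sub>R axis i 1)
      = pd i u (q + a *\<^sub>R axis i 1) * h" for h
    using linear_frechet_derivative[OF assms] unfolding pd_def by (simp add: linear_scale)
  ultimately show ?thesis unfolding has_field_derivative_def by simp
qed

text \<open>The mean value theorem in direction \<open>i\<close>, applied to the increment in direction \<open>j\<close>, followed by
  the mean value theorem in direction \<open>j\<close>. The left-hand side is symmetric in \<open>i\<close> and \<open>j\<close>, which is
  what makes the mixed derivatives agree.\<close>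

lemma second_difference_mean_value:
  fixes u :: "real^2 \<Rightarrow> real"
  assumes sub: "ball p (3 * h) \<subseteq> U" and h: "0 < h" and u: "Ck_on 2 U u"
  shows "\<exists>q\<in>ball p (3 * h). u (p + h *\<^sub>R axis i 1 + h *\<^sub>R axis j 1) - u (p + h *\<^sub>R axis i 1)
     - u (p + h *\<^sub>R axis j 1) + u p = h\<^sup>2 * pd j (pd i u) q"
proof -
  have in_ball: "p + b *\<^sub>R axis j 1 + a *\<^sub>R axis i 1 \<in> ball p (3*h)"
    if "0 \<le> a" "a \<le> h" "0 \<le> b" "b \<le> h" for a b
  proof -
    have "norm (b *\<^sub>R axis j (1::real) + a *\<^sub>R axis i (1::real) :: real^2) \<le> b + a"
      by (rule order_trans[OF norm_triangle_ineq]) (use that in \<open>simp add: norm_axis_1\<close>)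
    then have "dist (p + (b *\<^sub>R axis j 1 + a *\<^sub>R axis i 1)) p < 3 * h"
      using that h by (simp add: dist_norm)
    then show ?thesis by (simp add: dist_commute add.assoc)
  qed
  have u2: "Ck_on (Suc (Suc 0)) U u" using u by (simp add: numeral_2_eq_2)
  have d1: "u differentiable (at q)" "pd i u differentiable (at q)" if "q \<in> ball p (3*h)" for q
    using u2 sub that by auto
  define \<phi> where "\<phi> a = u (p + h *\<^sub>R axis j 1 + a *\<^sub>R axis i 1) - u (p + a *\<^sub>R axis i 1)" for a
  define \<phi>' where "\<phi>' a = pd i u (p + h *\<^sub>R axis j 1 + a *\<^sub>R axis i 1) - pd i u (p + a *\<^sub>R axis i 1)" for a
  have "(\<phi> has_real_derivative \<phi>' a) (at a)" if "0 \<le> a" "a \<le> h" for a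
    unfolding \<phi>_def \<phi>'_def using d1(1)[OF in_ball[of a h]] d1(1)[OF in_ball[of a 0]] that h
    by (intro DERIV_diff pd_line) auto
  then obtain a where a: "0 < a" "a < h" "\<phi> h - \<phi> 0 = h * \<phi>' a"
    using MVT2[OF h, of \<phi> \<phi>'] by auto
  define \<psi> where "\<psi> b = pd i u (p + a *\<^sub>R axis i 1 + b *\<^sub>R axis j 1)" for b
  have "(\<psi> has_real_derivative pd j (pd i u) (p + a *\<^sub>R axis i 1 + b *\<^sub>R axis j 1)) (at b)"
    if "0 \<le> b" "b \<le> h" for b
    unfolding \<psi>_def using d1(2)[OF in_ball[of a b]] that a(1,2) by (intro pd_line) (simp add: ac_simps)
  from MVT2[OF h this] obtain b where b: "0 < b" "b < h"
    "\<psi> h - \<psi> 0 = h * pd j (pd i u) (p + a *\<^sub>R axis i 1 + b *\<^sub>R axis j 1)" by auto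
  have "\<phi> h - \<phi> 0 = h\<^sup>2 * pd j (pd i u) (p + a *\<^sub>R axis i 1 + b *\<^sub>R axis j 1)"
    using a(3) b(3) unfolding \<phi>'_def \<psi>_def by (simp add: power2_eq_square ac_simps)
  moreover have "p + a *\<^sub>R axis i 1 + b *\<^sub>R axis j 1 \<in> ball p (3*h)"
    using in_ball[of a b] a b by (simp add: ac_simps)
  ultimately show ?thesis unfolding \<phi>_def
    by (intro bexI[of _ "p + a *\<^sub>R axis i 1 + b *\<^sub>R axis j 1"]) (auto simp: ac_simps)
qed

text \<open>Both mixed derivatives are limits of the same second difference.\<close>

lemma pd_commute:
  fixes u :: "real^2 \<Rightarrow> real"
  assumes U: "open U" "p \<in> U" and u: "Ck_on 2 U u"
  shows "pd i (pd j u) p = pd j (pd i u) p"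
proof (rule ccontr)
  assume ne: "pd i (pd j u) p \<noteq> pd j (pd i u) p"
  define e where "e = \<bar>pd i (pd j u) p - pd j (pd i u) p\<bar> / 2"
  have e: "e > 0" using ne by (simp add: e_def)
  have u2: "Ck_on (Suc (Suc 0)) U u" using u by (simp add: numeral_2_eq_2)
  have c: "continuous (at p) (pd i (pd j u))" "continuous (at p) (pd j (pd i u))"
    using u2 U by (auto simp: continuous_on_eq_continuous_at)
  obtain d1 where d1: "d1 > 0" "\<And>q. dist q p < d1 \<Longrightarrow> dist (pd i (pd j u) q) (pd i (pd j u) p) < e"
    using c(1) e unfolding continuous_at_eps_delta by blast
  obtain d2 where d2: "d2 > 0" "\<And>q. dist q p < d2 \<Longrightarrow> dist (pd j (pd i u) q) (pd j (pd i u) p) < e"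
    using c(2) e unfolding continuous_at_eps_delta by blast
  obtain d3 where d3: "d3 > 0" "ball p d3 \<subseteq> U" using U open_contains_ball by blast
  (* The second difference with step h stays inside the ball of radius 3 h. *)
  define h where "h = Min {d1, d2, d3} / 3"
  have h: "h > 0" "3 * h \<le> d1" "3 * h \<le> d2" "3 * h \<le> d3" using d1(1) d2(1) d3(1) by (auto simp: h_def)
  have sub: "ball p (3*h) \<subseteq> U" using d3 h by fastforce
  obtain q1 where q1: "q1\<in>ball p (3 * h)" "u (p + h *\<^sub>R axis i 1 + h *\<^sub>R axis j 1) - u (p + h *\<^sub>R axis i 1)
     - u (p + h *\<^sub>R axis j 1) + u p = h\<^sup>2 * pd j (pd i u) q1"
    using second_difference_mean_value[OF sub h(1) u] by blast
  obtain q2 where q2: "q2\<in>ball p (3 * h)" "u (p + h *\<^sub>R axis j 1 + h *\<^sub>R axis i 1) - u (p + h *\<^sub>R axis j 1)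
     - u (p + h *\<^sub>R axis i 1) + u p = h\<^sup>2 * pd i (pd j u) q2"
    using second_difference_mean_value[OF sub h(1) u] by blast
  have "u (p + h *\<^sub>R axis i 1 + h *\<^sub>R axis j 1) = u (p + h *\<^sub>R axis j 1 + h *\<^sub>R axis i 1)"
    by (simp add: ac_simps)
  then have "h\<^sup>2 * pd j (pd i u) q1 = h\<^sup>2 * pd i (pd j u) q2" using q1(2) q2(2) by linarith
  then have "pd j (pd i u) q1 = pd i (pd j u) q2" using h by simp
  moreover have "dist (pd j (pd i u) q1) (pd j (pd i u) p) < e"
    using q1(1) h by (intro d2(2)) (simp add: dist_commute)
  moreover have "dist (pd i (pd j u) q2) (pd i (pd j u) p) < e"
    using q2(1) h by (intro d1(2)) (simp add: dist_commute)
  ultimately show False unfolding e_def dist_real_def by (simp add: abs_if split: if_splits)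
qed

section \<open>Warped products in arbitrary coordinates\<close>

text \<open>The metric \<open>ds\<^sup>2 + F(s) dt\<^sup>2\<close>, written in coordinates in which \<open>s\<close> and \<open>t\<close> are arbitrary functions
  with independent differentials.\<close>

locale warped_coordinates =
  fixes U :: "(real^2) set" and s t :: "real^2 \<Rightarrow> real" and F F' F'' :: "real \<Rightarrow> real"
    and g :: "real^2 \<Rightarrow> real^2^2"
  assumes U: "open U" and s: "smooth_on U s" and t: "smooth_on U t"
    and F: "\<And>x. (F has_real_derivative F' x) (at x)"
    and F': "\<And>x. (F' has_real_derivative F'' x) (at x)"
    and F_pos: "\<And>x. 0 < F x"
    and g: "\<And>q. q \<in> U \<Longrightarrow> g q = (\<chi> i j. pd i s q * pd j s q + F (s q) * (pd i t q * pd j t q))"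
    and jac: "\<And>q. q \<in> U \<Longrightarrow> pd 1 s q * pd 2 t q - pd 2 s q * pd 1 t q \<noteq> 0"
begin

abbreviation jacobian :: "real^2 \<Rightarrow> real" where "jacobian q \<equiv> pd 1 s q * pd 2 t q - pd 2 s q * pd 1 t q"

lemma coord_diff [simp]:
  assumes "q \<in> U"
  shows "s differentiable (at q)" "t differentiable (at q)"
    "pd i s differentiable (at q)" "pd i t differentiable (at q)"
    "pd i (pd j s) differentiable (at q)" "pd i (pd j t) differentiable (at q)"
    "(\<lambda>p. F (s p)) differentiable (at q)" "(\<lambda>p. F' (s p)) differentiable (at q)"
proof -
  show "s differentiable (at q)" "t differentiable (at q)"
    "pd i s differentiable (at q)" "pd i t differentiable (at q)"
    "pd i (pd j s) differentiable (at q)" "pd i (pd j t) differentiable (at q)"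
    using smooth_on_differentiable[OF _ assms] smooth_on_pd s t by metis+
  then show "(\<lambda>p. F (s p)) differentiable (at q)" "(\<lambda>p. F' (s p)) differentiable (at q)"
    using pd_comp(2)[OF F] pd_comp(2)[OF F'] by blast+
qed

lemma coord_commute:
  assumes "q \<in> U"
  shows "pd i (pd j s) q = pd j (pd i s) q" "pd i (pd j t) q = pd j (pd i t) q"
    "pd i (pd j (pd k s)) q = pd j (pd i (pd k s)) q" "pd i (pd j (pd k t)) q = pd j (pd i (pd k t)) q"
proof -
  have *: "smooth_on U u \<Longrightarrow> pd i (pd j u) q = pd j (pd i u) q" for u :: "real^2 \<Rightarrow> real"
    using pd_commute[OF U assms] unfolding smooth_on_def by blast
  show "pd i (pd j s) q = pd j (pd i s) q" "pd i (pd j t) q = pd j (pd i t) q"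
    "pd i (pd j (pd k s)) q = pd j (pd i (pd k s)) q" "pd i (pd j (pd k t)) q = pd j (pd i (pd k t)) q"
    using * smooth_on_pd s t by blast+
qed

lemma det_g: assumes "q \<in> U" shows "det (g q) = F (s q) * (jacobian q)\<^sup>2"
  using assms by (simp add: g det_2 power2_eq_square algebra_simps)

lemma g_inverse:
  assumes "q \<in> U" shows "(\<Sum>k\<in>UNIV. g q $ a $ k * matrix_inv (g q) $ k $ b) = (if a = b then 1 else 0)"
proof -
  have "invertible (g q)" using jac[OF assms] F_pos[of "s q"] by (simp add: invertible_det_nz det_g[OF assms])
  then have "g q ** matrix_inv (g q) = mat 1" unfolding matrix_inv_def invertible_def by (rule someI2_ex) simp
  then have "(g q ** matrix_inv (g q)) $ a $ b = mat 1 $ a $ b" by simp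
  then show ?thesis by (simp add: matrix_matrix_mult_def mat_def)
qed

text \<open>A vector is determined by its contractions with \<open>ds\<close> and \<open>dt\<close>. For the
  Christoffel symbols and for the gradient, lowering an index with \<open>g\<close> and cancelling with this lemma
  replaces the computation of the inverse of \<open>g\<close>.\<close>

lemma linear_system_unique:
  assumes q: "q \<in> U" and e: "\<And>a. pd a s q * P + F (s q) * pd a t q * Q = pd a s q * A + F (s q) * pd a t q * B"
  shows "P = A" "Q = B"
proof -
  have 1: "pd 1 s q * (P - A) + F (s q) * pd 1 t q * (Q - B) = 0"
    and 2: "pd 2 s q * (P - A) + F (s q) * pd 2 t q * (Q - B) = 0"
    using e[of 1] e[of 2] by (simp_all add: algebra_simps)
  have "jacobian q * (P - A) = pd 2 t q * (pd 1 s q * (P - A) + F (s q) * pd 1 t q * (Q - B))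
     - pd 1 t q * (pd 2 s q * (P - A) + F (s q) * pd 2 t q * (Q - B))" by (simp add: algebra_simps)
  with 1 2 jac[OF q] show "P = A" by simp
  have "jacobian q * (F (s q) * (Q - B)) = pd 1 s q * (pd 2 s q * (P - A) + F (s q) * pd 2 t q * (Q - B))
     - pd 2 s q * (pd 1 s q * (P - A) + F (s q) * pd 1 t q * (Q - B))" by (simp add: algebra_simps)
  with 1 2 jac[OF q] F_pos[of "s q"] show "Q = B" by simp
qed

lemma pd_g:
  assumes q: "q \<in> U"
  shows "pd n (\<lambda>q. g q $ i $ j) q = pd n (pd i s) q * pd j s q + pd i s q * pd n (pd j s) q
     + F' (s q) * pd n s q * (pd i t q * pd j t q)
     + F (s q) * (pd n (pd i t) q * pd j t q + pd i t q * pd n (pd j t) q)"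
proof -
  have "pd n (\<lambda>q. g q $ i $ j) q = pd n (\<lambda>q. pd i s q * pd j s q + F (s q) * (pd i t q * pd j t q)) q"
    by (rule pd_cong[OF U q]) (simp add: g)
  also have "\<dots> = pd n (pd i s) q * pd j s q + pd i s q * pd n (pd j s) q
     + F' (s q) * pd n s q * (pd i t q * pd j t q)
     + F (s q) * (pd n (pd i t) q * pd j t q + pd i t q * pd n (pd j t) q)"
    using q by (simp add: pd_add pd_mult pd_comp(1)[OF F] algebra_simps)
  finally show ?thesis .
qed

text \<open>The \<open>s\<close> and \<open>t\<close> components of the covariant derivative of \<open>\<partial>\<^sub>j\<close> along \<open>\<partial>\<^sub>i\<close>: the second derivative
  of the coordinate function, plus the Christoffel symbols of \<open>ds\<^sup>2 + F dt\<^sup>2\<close>, namely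
  \<open>\<Gamma>\<^sup>s\<^sub>t\<^sub>t = - F'/2\<close> and \<open>\<Gamma>\<^sup>t\<^sub>s\<^sub>t = F'/(2 F)\<close>, applied to the differentials.\<close>

abbreviation chr_s :: "2 \<Rightarrow> 2 \<Rightarrow> real^2 \<Rightarrow> real" where "chr_s i j q \<equiv> pd i (pd j s) q - F' (s q) / 2 * (pd i t q * pd j t q)"
abbreviation chr_t :: "2 \<Rightarrow> 2 \<Rightarrow> real^2 \<Rightarrow> real" where "chr_t i j q \<equiv> pd i (pd j t) q + F' (s q) / (2 * F (s q)) * (pd i s q * pd j t q + pd j s q * pd i t q)"

lemma christoffel_transform:
  assumes q: "q \<in> U"
  shows "christoffel g 1 i j q * pd 1 s q + christoffel g 2 i j q * pd 2 s q = chr_s i j q"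
    and "christoffel g 1 i j q * pd 1 t q + christoffel g 2 i j q * pd 2 t q = chr_t i j q"
proof -
  define c where "c l = (pd i (\<lambda>q. g q $ j $ l) q + pd j (\<lambda>q. g q $ i $ l) q - pd l (\<lambda>q. g q $ i $ j) q) / 2" for l
  have c: "c l = pd l s q * chr_s i j q + F (s q) * pd l t q * chr_t i j q" for l
    using F_pos[of "s q"] coord_commute(1,2)[OF q, of i j] coord_commute(1,2)[OF q, of l j] coord_commute(1,2)[OF q, of l i]
    unfolding c_def by (simp add: pd_g[OF q] field_simps)
  have sys: "(\<Sum>k\<in>UNIV. g q $ a $ k * christoffel g k i j q) = c a" for a
  proof -
    have "(\<Sum>k\<in>UNIV. g q $ a $ k * christoffel g k i j q)
        = (\<Sum>k\<in>UNIV. \<Sum>l\<in>UNIV. g q $ a $ k * matrix_inv (g q) $ k $ l * c l)"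
      unfolding christoffel_def c_def sum_divide_distrib sum_distrib_left by (simp add: mult.assoc)
    also have "\<dots> = (\<Sum>l\<in>UNIV. (\<Sum>k\<in>UNIV. g q $ a $ k * matrix_inv (g q) $ k $ l) * c l)"
      by (subst sum.swap) (simp add: sum_distrib_right)
    also have "\<dots> = c a" unfolding g_inverse[OF q] using exhaust_2[of a] by (elim disjE) (simp_all add: sum_2)
    finally show ?thesis .
  qed
  have "pd a s q * (christoffel g 1 i j q * pd 1 s q + christoffel g 2 i j q * pd 2 s q)
     + F (s q) * pd a t q * (christoffel g 1 i j q * pd 1 t q + christoffel g 2 i j q * pd 2 t q)
     = pd a s q * chr_s i j q + F (s q) * pd a t q * chr_t i j q" for a
    using sys[of a] unfolding c[of a, symmetric] by (simp add: sum_2 g[OF q] algebra_simps)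
  from linear_system_unique[OF q this]
  show "christoffel g 1 i j q * pd 1 s q + christoffel g 2 i j q * pd 2 s q = chr_s i j q"
    "christoffel g 1 i j q * pd 1 t q + christoffel g 2 i j q * pd 2 t q = chr_t i j q" .
qed

text \<open>Solving the transformation law by Cramer's rule; the formulas serve to show that the Christoffel
  symbols are differentiable.\<close>

lemma christoffel_explicit:
  assumes q: "q \<in> U"
  shows "christoffel g 1 i j q = (chr_s i j q * pd 2 t q - chr_t i j q * pd 2 s q) / jacobian q"
    and "christoffel g 2 i j q = (chr_t i j q * pd 1 s q - chr_s i j q * pd 1 t q) / jacobian q"
  unfolding christoffel_transform[OF q, symmetric]
  using jac[OF q] by (simp_all add: field_simps)

lemma chr_diff:
  assumes q: "q \<in> U"
  shows "chr_s i j differentiable (at q)" "chr_t i j differentiable (at q)"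
  using q F_pos[of "s q"] by (auto intro!: differentiable_diff differentiable_add differentiable_mult
      differentiable_divide differentiable_const)

lemma christoffel_diff:
  assumes q: "q \<in> U"
  shows "christoffel g k i j differentiable (at q)"
proof -
  have "(\<lambda>q. (chr_s i j q * pd 2 t q - chr_t i j q * pd 2 s q) / jacobian q) differentiable (at q)"
    "(\<lambda>q. (chr_t i j q * pd 1 s q - chr_s i j q * pd 1 t q) / jacobian q) differentiable (at q)"
    using q jac[OF q] chr_diff[OF q, of i j] by (auto intro!: differentiable_diff differentiable_mult
      differentiable_divide)
  then have "christoffel g 1 i j differentiable (at q)" "christoffel g 2 i j differentiable (at q)"
    by (auto intro: differentiable_cong_open[OF U q] simp: christoffel_explicit)
  then show ?thesis using exhaust_2[of k] by auto
qed

text \<open>With \<open>F = f\<^sup>2\<close> this is \<open>- f'' / f\<close>, the curvature of \<open>ds\<^sup>2 + f\<^sup>2 dt\<^sup>2\<close>.\<close>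

definition warped_curvature :: "real \<Rightarrow> real" where
  "warped_curvature x = (F' x)\<^sup>2 / (4 * (F x)\<^sup>2) - F'' x / (2 * F x)"

lemma pd_chr_s:
  assumes q: "q \<in> U"
  shows "pd n (chr_s i j) q = pd n (pd i (pd j s)) q - F'' (s q) / 2 * pd n s q * (pd i t q * pd j t q)
    - F' (s q) / 2 * (pd n (pd i t) q * pd j t q + pd i t q * pd n (pd j t) q)"
proof -
  define h where "h x = - F' x / 2" for x
  have h: "(h has_real_derivative - F'' x / 2) (at x)" for x
    unfolding h_def by (auto intro!: derivative_eq_intros F')
  have "chr_s i j = (\<lambda>q. pd i (pd j s) q + h (s q) * (pd i t q * pd j t q))" by (simp add: h_def)
  moreover have "pd n (\<lambda>q. pd i (pd j s) q + h (s q) * (pd i t q * pd j t q)) q = pd n (pd i (pd j s)) q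
    + (h (s q) * (pd i t q * pd n (pd j t) q + pd n (pd i t) q * pd j t q)
       + (- F'' (s q) / 2 * pd n s q) * (pd i t q * pd j t q))"
    using q pd_comp(2)[OF h, of s q] by (simp only: pd_add pd_mult pd_comp(1)[OF h] differentiable_mult coord_diff)
  ultimately show ?thesis by (simp add: h_def algebra_simps)
qed

lemma pd_chr_t:
  assumes q: "q \<in> U"
  shows "pd n (chr_t i j) q = pd n (pd i (pd j t)) q
    + (F'' (s q) / (2 * F (s q)) - (F' (s q))\<^sup>2 / (2 * (F (s q))\<^sup>2)) * pd n s q * (pd i s q * pd j t q + pd j s q * pd i t q)
    + F' (s q) / (2 * F (s q)) * (pd n (pd i s) q * pd j t q + pd i s q * pd n (pd j t) q
        + pd n (pd j s) q * pd i t q + pd j s q * pd n (pd i t) q)"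
proof -
  define h where "h x = F' x / (2 * F x)" for x
  define h' where "h' x = F'' x / (2 * F x) - (F' x)\<^sup>2 / (2 * (F x)\<^sup>2)" for x
  have h: "(h has_real_derivative h' x) (at x)" for x
    unfolding h_def h'_def using F_pos[of x]
    by (auto intro!: derivative_eq_intros F F' simp: field_simps power2_eq_square)
  have "chr_t i j = (\<lambda>q. pd i (pd j t) q + h (s q) * (pd i s q * pd j t q + pd j s q * pd i t q))"
    by (simp add: h_def)
  moreover have "pd n (\<lambda>q. pd i (pd j t) q + h (s q) * (pd i s q * pd j t q + pd j s q * pd i t q)) q
     = pd n (pd i (pd j t)) q + (h (s q) * (pd i s q * pd n (pd j t) q + pd n (pd i s) q * pd j t q
          + (pd j s q * pd n (pd i t) q + pd n (pd j s) q * pd i t q))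
        + h' (s q) * pd n s q * (pd i s q * pd j t q + pd j s q * pd i t q))"
    using q pd_comp(2)[OF h, of s q]
    by (simp only: pd_add pd_mult pd_comp(1)[OF h] differentiable_mult differentiable_add coord_diff)
  ultimately show ?thesis unfolding h_def h'_def by (simp only:) (simp add: algebra_simps)
qed

text \<open>The product rule applied to the transformation law of the Christoffel symbols.\<close>

lemma pd_christoffel:
  assumes q: "q \<in> U"
  shows "pd n (christoffel g 1 i j) q * pd 1 s q + pd n (christoffel g 2 i j) q * pd 2 s q
     = pd n (chr_s i j) q - christoffel g 1 i j q * pd n (pd 1 s) q - christoffel g 2 i j q * pd n (pd 2 s) q"
   and "pd n (christoffel g 1 i j) q * pd 1 t q + pd n (christoffel g 2 i j) q * pd 2 t q
     = pd n (chr_t i j) q - christoffel g 1 i j q * pd n (pd 1 t) q - christoffel g 2 i j q * pd n (pd 2 t) q"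
proof -
  have "pd n (\<lambda>q. christoffel g 1 i j q * pd 1 s q + christoffel g 2 i j q * pd 2 s q) q = pd n (chr_s i j) q"
    by (rule pd_cong[OF U q]) (simp add: christoffel_transform)
  then show "pd n (christoffel g 1 i j) q * pd 1 s q + pd n (christoffel g 2 i j) q * pd 2 s q
     = pd n (chr_s i j) q - christoffel g 1 i j q * pd n (pd 1 s) q - christoffel g 2 i j q * pd n (pd 2 s) q"
    using q christoffel_diff[OF q] by (simp add: pd_add pd_mult differentiable_mult)
  have "pd n (\<lambda>q. christoffel g 1 i j q * pd 1 t q + christoffel g 2 i j q * pd 2 t q) q = pd n (chr_t i j) q"
    by (rule pd_cong[OF U q]) (simp add: christoffel_transform)
  then show "pd n (christoffel g 1 i j) q * pd 1 t q + pd n (christoffel g 2 i j) q * pd 2 t q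
     = pd n (chr_t i j) q - christoffel g 1 i j q * pd n (pd 1 t) q - christoffel g 2 i j q * pd n (pd 2 t) q"
    using q christoffel_diff[OF q] by (simp add: pd_add pd_mult differentiable_mult)
qed

text \<open>Contracting the curvature with \<open>ds\<close> turns the derivatives of the Christoffel symbols into
  derivatives of \<open>chr_s\<close>. The terms that pair second derivatives of \<open>s\<close> with Christoffel symbols
  cancel against the quadratic terms, and the third derivatives of \<open>s\<close> cancel by symmetry. Only
  first derivatives of \<open>s\<close> and \<open>t\<close> remain. The same happens for \<open>dt\<close>.\<close>

lemma curvature_transform:
  assumes q: "q \<in> U"
  shows "riemann_curvature g 1 2 1 2 q * pd 1 s q + riemann_curvature g 2 2 1 2 q * pd 2 s q
      = warped_curvature (s q) * F (s q) * jacobian q * pd 2 t q"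
    and "riemann_curvature g 1 2 1 2 q * pd 1 t q + riemann_curvature g 2 2 1 2 q * pd 2 t q
      = - warped_curvature (s q) * jacobian q * pd 2 s q"
proof -
  let ?G = "\<lambda>k i j. christoffel g k i j q"
  have R: "riemann_curvature g l 2 1 2 q = pd 1 (christoffel g l 2 2) q - pd 2 (christoffel g l 1 2) q
     + (?G l 1 1 * ?G 1 2 2 - ?G l 2 1 * ?G 1 1 2) + (?G l 1 2 * ?G 2 2 2 - ?G l 2 2 * ?G 2 1 2)" for l
    unfolding riemann_curvature_def by (simp add: sum_2)
  have comb: "riemann_curvature g 1 2 1 2 q * a + riemann_curvature g 2 2 1 2 q * b
    = (pd 1 (christoffel g 1 2 2) q * a + pd 1 (christoffel g 2 2 2) q * b)
    - (pd 2 (christoffel g 1 1 2) q * a + pd 2 (christoffel g 2 1 2) q * b)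
    + (?G 1 1 1 * a + ?G 2 1 1 * b) * ?G 1 2 2 - (?G 1 2 1 * a + ?G 2 2 1 * b) * ?G 1 1 2
    + (?G 1 1 2 * a + ?G 2 1 2 * b) * ?G 2 2 2 - (?G 1 2 2 * a + ?G 2 2 2 * b) * ?G 2 1 2" for a b
    unfolding R by (simp add: algebra_simps)
  note sym = coord_commute(1)[OF q, of 2 1] coord_commute(2)[OF q, of 2 1]
     coord_commute(3)[OF q, of 2 1 2] coord_commute(4)[OF q, of 2 1 2]
  have "riemann_curvature g 1 2 1 2 q * pd 1 s q + riemann_curvature g 2 2 1 2 q * pd 2 s q
    = pd 1 (chr_s 2 2) q - pd 2 (chr_s 1 2) q
     - F' (s q) / 2 * (pd 1 t q * (?G 1 2 2 * pd 1 t q + ?G 2 2 2 * pd 2 t q)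
        - pd 2 t q * (?G 1 1 2 * pd 1 t q + ?G 2 1 2 * pd 2 t q))"
    unfolding comb pd_christoffel(1)[OF q] christoffel_transform(1)[OF q]
    by (simp add: sym algebra_simps)
  also have "\<dots> = pd 1 (chr_s 2 2) q - pd 2 (chr_s 1 2) q
     - F' (s q) / 2 * (pd 1 t q * chr_t 2 2 q - pd 2 t q * chr_t 1 2 q)"
    unfolding christoffel_transform(2)[OF q] by simp
  also have "\<dots> = warped_curvature (s q) * F (s q) * jacobian q * pd 2 t q"
    unfolding pd_chr_s[OF q]
    using F_pos[of "s q"] by (simp add: sym warped_curvature_def field_simps power2_eq_square)
  finally show "riemann_curvature g 1 2 1 2 q * pd 1 s q + riemann_curvature g 2 2 1 2 q * pd 2 s q
      = warped_curvature (s q) * F (s q) * jacobian q * pd 2 t q" .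
  (* In the next step the products with ds and dt have the Christoffel symbols as second factor, so
     that unfolding the transformation law leaves them alone. *)
  define h where "h = F' (s q) / (2 * F (s q))"
  have "riemann_curvature g 1 2 1 2 q * pd 1 t q + riemann_curvature g 2 2 1 2 q * pd 2 t q
    = pd 1 (chr_t 2 2) q - pd 2 (chr_t 1 2) q
     + h * (pd 1 t q * (pd 1 s q * ?G 1 2 2 + pd 2 s q * ?G 2 2 2)
        - pd 2 t q * (pd 1 s q * ?G 1 1 2 + pd 2 s q * ?G 2 1 2)
        + pd 1 s q * (pd 1 t q * ?G 1 2 2 + pd 2 t q * ?G 2 2 2)
        - pd 2 s q * (pd 1 t q * ?G 1 1 2 + pd 2 t q * ?G 2 1 2))"
    unfolding comb pd_christoffel(2)[OF q] christoffel_transform(2)[OF q] h_def[symmetric]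
    by (simp add: sym algebra_simps)
  also have "\<dots> = pd 1 (chr_t 2 2) q - pd 2 (chr_t 1 2) q
     + h * (pd 1 t q * chr_s 2 2 q - pd 2 t q * chr_s 1 2 q
        + pd 1 s q * chr_t 2 2 q - pd 2 s q * chr_t 1 2 q)"
    unfolding christoffel_transform[OF q, symmetric] by (simp add: mult.commute)
  also have "\<dots> = - warped_curvature (s q) * jacobian q * pd 2 s q"
    unfolding pd_chr_t[OF q] h_def
    using F_pos[of "s q"] by (simp add: sym warped_curvature_def field_simps power2_eq_square)
  finally show "riemann_curvature g 1 2 1 2 q * pd 1 t q + riemann_curvature g 2 2 1 2 q * pd 2 t q
      = - warped_curvature (s q) * jacobian q * pd 2 s q" .
qed

lemma gauss_curvature_warped:
  assumes q: "q \<in> U"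
  shows "gauss_curvature g q = warped_curvature (s q)"
proof -
  have "(\<Sum>l\<in>UNIV. g q $ 1 $ l * riemann_curvature g l 2 1 2 q)
     = pd 1 s q * (riemann_curvature g 1 2 1 2 q * pd 1 s q + riemann_curvature g 2 2 1 2 q * pd 2 s q)
     + F (s q) * pd 1 t q * (riemann_curvature g 1 2 1 2 q * pd 1 t q + riemann_curvature g 2 2 1 2 q * pd 2 t q)"
    by (simp add: sum_2 g[OF q] algebra_simps)
  also have "\<dots> = warped_curvature (s q) * (F (s q) * (jacobian q)\<^sup>2)"
    unfolding curvature_transform[OF q] by (simp add: power2_eq_square algebra_simps)
  finally show ?thesis unfolding gauss_curvature_def det_g[OF q] using F_pos[of "s q"] jac[OF q] by simp
qed

context
  fixes u :: "real^2 \<Rightarrow> real" and \<kappa> \<kappa>' :: "real \<Rightarrow> real"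
  assumes u: "\<And>q. q \<in> U \<Longrightarrow> u q = \<kappa> (s q)"
    and \<kappa>: "\<And>x. (\<kappa> has_real_derivative \<kappa>' x) (at x)"
begin

lemma pd_radial: "q \<in> U \<Longrightarrow> pd i u q = \<kappa>' (s q) * pd i s q"
  using pd_cong[OF U, of q u "\<lambda>q. \<kappa> (s q)"] pd_comp(1)[OF \<kappa>, of s q] u by simp

text \<open>The gradient is the vector whose contraction with \<open>ds\<close> is \<open>\<kappa>'\<close> and with \<open>dt\<close> is \<open>0\<close>; the
  components follow by Cramer's rule.\<close>

lemma gradient_radial:
  assumes q: "q \<in> U"
  shows "gradient g u q $ 1 * pd 1 s q + gradient g u q $ 2 * pd 2 s q = \<kappa>' (s q)"
    and "gradient g u q $ 1 * pd 1 t q + gradient g u q $ 2 * pd 2 t q = 0"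
    and "gradient g u q $ 1 = \<kappa>' (s q) * pd 2 t q / jacobian q"
    and "gradient g u q $ 2 = - \<kappa>' (s q) * pd 1 t q / jacobian q"
proof -
  define v where "v = gradient g u q"
  have sys: "(\<Sum>k\<in>UNIV. g q $ a $ k * v $ k) = \<kappa>' (s q) * pd a s q" for a
  proof -
    have "(\<Sum>k\<in>UNIV. g q $ a $ k * v $ k)
        = (\<Sum>k\<in>UNIV. \<Sum>l\<in>UNIV. g q $ a $ k * matrix_inv (g q) $ k $ l * pd l u q)"
      unfolding v_def gradient_def matrix_vector_mult_def by (simp add: sum_distrib_left mult.assoc)
    also have "\<dots> = (\<Sum>l\<in>UNIV. (\<Sum>k\<in>UNIV. g q $ a $ k * matrix_inv (g q) $ k $ l) * pd l u q)"
      by (subst sum.swap) (simp add: sum_distrib_right)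
    also have "\<dots> = \<kappa>' (s q) * pd a s q" unfolding g_inverse[OF q] using exhaust_2[of a]
      by (elim disjE) (simp_all add: sum_2 pd_radial[OF q])
    finally show ?thesis .
  qed
  have "pd a s q * (v $ 1 * pd 1 s q + v $ 2 * pd 2 s q)
     + F (s q) * pd a t q * (v $ 1 * pd 1 t q + v $ 2 * pd 2 t q)
     = pd a s q * \<kappa>' (s q) + F (s q) * pd a t q * 0" for a
    using sys[of a] by (simp add: sum_2 g[OF q] algebra_simps)
  note * = linear_system_unique[OF q this]
  from * show "gradient g u q $ 1 * pd 1 s q + gradient g u q $ 2 * pd 2 s q = \<kappa>' (s q)"
    "gradient g u q $ 1 * pd 1 t q + gradient g u q $ 2 * pd 2 t q = 0"
    unfolding v_def by simp_all
  show "gradient g u q $ 1 = \<kappa>' (s q) * pd 2 t q / jacobian q"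
  proof -
    have "v $ 1 * jacobian q = (v $ 1 * pd 1 s q + v $ 2 * pd 2 s q) * pd 2 t q
       - (v $ 1 * pd 1 t q + v $ 2 * pd 2 t q) * pd 2 s q" by (simp add: algebra_simps)
    then show ?thesis unfolding * v_def[symmetric] by (intro eq_divide_imp[OF jac[OF q]]) simp
  qed
  show "gradient g u q $ 2 = - \<kappa>' (s q) * pd 1 t q / jacobian q"
  proof -
    have "v $ 2 * jacobian q = (v $ 1 * pd 1 t q + v $ 2 * pd 2 t q) * pd 1 s q
       - (v $ 1 * pd 1 s q + v $ 2 * pd 2 s q) * pd 1 t q" by (simp add: algebra_simps)
    then show ?thesis unfolding * v_def[symmetric] by (intro eq_divide_imp[OF jac[OF q]]) simp
  qed
qed

lemma norm_gradient_radial: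
  assumes q: "q \<in> U"
  shows "metric_norm_sq g q (gradient g u q) = (\<kappa>' (s q))\<^sup>2"
proof -
  have "metric_norm_sq g q v = (v $ 1 * pd 1 s q + v $ 2 * pd 2 s q)\<^sup>2
     + F (s q) * (v $ 1 * pd 1 t q + v $ 2 * pd 2 t q)\<^sup>2" for v
    unfolding metric_norm_sq_def
    by (simp add: inner_vec_def matrix_vector_mult_def sum_2 g[OF q] power2_eq_square algebra_simps)
  then show ?thesis by (simp add: gradient_radial(1,2)[OF q])
qed

text \<open>The density is \<open>sqrt F\<close> times the absolute value of the Jacobian, and the Jacobian cancels the
  denominator of the gradient. So, up to a locally constant sign, the flux is \<open>w(s)\<close> times the
  rotated differential of \<open>t\<close>, which is divergence free, and only the derivative of \<open>w\<close> survives.\<close>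

lemma laplace_beltrami_radial:
  assumes q: "q \<in> U"
    and w: "\<And>x. ((\<lambda>x. sqrt (F x) * \<kappa>' x) has_real_derivative w' x) (at x)"
  shows "laplace_beltrami g u q = w' (s q) / sqrt (F (s q))"
proof -
  let ?w = "\<lambda>q. sqrt (F (s q)) * \<kappa>' (s q)"
  (* The sign of the Jacobian at q is its sign on the neighbourhood W, which removes the absolute
     value before differentiating. *)
  define \<sigma> where "\<sigma> = sgn (jacobian q)"
  have \<sigma>: "\<sigma> * jacobian q = \<bar>jacobian q\<bar>" "\<sigma> * \<sigma> = 1" using jac[OF q] by (simp_all add: \<sigma>_def abs_sgn sgn_if mult.commute)
  define W where "W = {p\<in>U. 0 < \<sigma> * jacobian p}"
  have "continuous_on U (pd i s)" "continuous_on U (pd i t)" for i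
    using smooth_on_pd[OF s] smooth_on_pd[OF t] unfolding smooth_on_def by (metis Ck_on.simps(1))+
  then have "continuous_on U (\<lambda>p. \<sigma> * jacobian p)" by (intro continuous_intros)
  then have "open (U \<inter> (\<lambda>p. \<sigma> * jacobian p) -` {0<..})" by (rule continuous_open_preimage[OF _ U]) simp
  moreover have "W = U \<inter> (\<lambda>p. \<sigma> * jacobian p) -` {0<..}" by (auto simp: W_def)
  ultimately have W: "open W" by simp
  have qW: "q \<in> W" using q jac[OF q] \<sigma>(1) by (simp add: W_def)
  have sqrt_det: "sqrt (det (g p)) = sqrt (F (s p)) * (\<sigma> * jacobian p)" if "p \<in> W" for p
  proof -
    have p: "p \<in> U" "0 < \<sigma> * jacobian p" using that by (auto simp: W_def)
    have "(\<sigma> * jacobian p)\<^sup>2 = \<sigma> * \<sigma> * (jacobian p)\<^sup>2" by (simp add: power2_eq_square algebra_simps)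
    then have "(jacobian p)\<^sup>2 = (\<sigma> * jacobian p)\<^sup>2" using \<sigma>(2) by simp
    then show ?thesis using p(2) by (simp only: det_g[OF p(1)] real_sqrt_mult real_sqrt_abs)
  qed
  have 1: "sqrt (det (g p)) * gradient g u p $ 1 = \<sigma> * (?w p * pd 2 t p)"
    and 2: "sqrt (det (g p)) * gradient g u p $ 2 = (- \<sigma>) * (?w p * pd 1 t p)" if "p \<in> W" for p
  proof -
    have p: "p \<in> U" using that by (auto simp: W_def)
    show "sqrt (det (g p)) * gradient g u p $ 1 = \<sigma> * (?w p * pd 2 t p)"
      "sqrt (det (g p)) * gradient g u p $ 2 = (- \<sigma>) * (?w p * pd 1 t p)"
      unfolding sqrt_det[OF that] gradient_radial(3,4)[OF p] using jac[OF p] by simp_all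
  qed
  have c: "pd n (\<lambda>q. c * z q) q = c * pd n z q" if "z differentiable (at q)" for z :: "real^2 \<Rightarrow> real" and n c
  proof -
    have "pd n (\<lambda>q. c) q = (0::real)" by (auto intro!: pd_eqI[THEN trans] derivative_eq_intros)
    then show ?thesis using that by (simp add: pd_mult)
  qed
  have wd: "pd n ?w q = w' (s q) * pd n s q" "?w differentiable (at q)" for n
    using pd_comp[OF w, of s q] q by auto
  have "pd 1 (\<lambda>p. sqrt (det (g p)) * gradient g u p $ 1) q = pd 1 (\<lambda>p. \<sigma> * (?w p * pd 2 t p)) q"
    by (rule pd_cong[OF W qW 1])
  also have "\<dots> = \<sigma> * (w' (s q) * pd 1 s q * pd 2 t q + ?w q * pd 1 (pd 2 t) q)"
    using q wd by (simp only: c pd_mult differentiable_mult coord_diff) simp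
  finally have d1: "pd 1 (\<lambda>p. sqrt (det (g p)) * gradient g u p $ 1) q = \<dots>" .
  have "pd 2 (\<lambda>p. sqrt (det (g p)) * gradient g u p $ 2) q = pd 2 (\<lambda>p. (- \<sigma>) * (?w p * pd 1 t p)) q"
    by (rule pd_cong[OF W qW 2])
  also have "\<dots> = - \<sigma> * (w' (s q) * pd 2 s q * pd 1 t q + ?w q * pd 2 (pd 1 t) q)"
    using q wd by (simp only: c pd_mult differentiable_mult coord_diff) simp
  finally have d2: "pd 2 (\<lambda>p. sqrt (det (g p)) * gradient g u p $ 2) q = \<dots>" .
  have "laplace_beltrami g u q = w' (s q) * (\<sigma> * jacobian q) / (sqrt (F (s q)) * (\<sigma> * jacobian q))"
    unfolding laplace_beltrami_def sum_2 d1 d2 sqrt_det[OF qW]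
    by (simp add: coord_commute(2)[OF q, of 2 1] algebra_simps)
  moreover have "\<sigma> * jacobian q \<noteq> 0" using qW by (auto simp: W_def)
  ultimately show ?thesis by (simp only: nonzero_mult_divide_mult_cancel_right not_False_eq_True)
qed

end

end

section \<open>The profile curve\<close>

text \<open>The boundary values \<open>l = sqrt m\<close> and \<open>l = 1/2\<close> are included because the period is evaluated
  there.\<close>

locale rotational_profile =
  fixes m l :: real
  assumes m_pos: "0 < m" and m_le: "sqrt m \<le> l" and l_less: "l < (m + 1) / 2" and l_ge: "1/2 \<le> l" and m_less: "m < 1"
begin

abbreviation "amp \<equiv> sqrt (l\<^sup>2 - m)"

definition rho :: "real \<Rightarrow> real" where "rho s = l + amp * sin (2 * s)"

lemma f_eq: "f m l s = sqrt (rho s)"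
  by (simp add: f_def rho_def)

lemma m_le_l2: "m \<le> l\<^sup>2"
  using m_le m_pos by (simp add: sqrt_le_D)

lemma amp_bounds: "0 \<le> amp" "amp < l" "amp < 1 - l" "amp\<^sup>2 = l\<^sup>2 - m"
proof -
  have "sqrt (l\<^sup>2 - m) < sqrt (l\<^sup>2)" using m_pos by (simp only: real_sqrt_less_iff)
  then show "amp < l" using l_ge by simp
  have "l < 1" using l_less m_less by simp
  have "sqrt (l\<^sup>2 - m) < sqrt ((1 - l)\<^sup>2)"
    using l_less by (simp only: real_sqrt_less_iff) (simp add: power2_eq_square algebra_simps)
  then show "amp < 1 - l" using \<open>l < 1\<close> by simp
  show "0 \<le> amp" "amp\<^sup>2 = l\<^sup>2 - m" using m_le_l2 by auto
qed

lemma amp_sin: "\<bar>amp * sin x\<bar> \<le> amp"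
proof -
  have "amp * \<bar>sin x\<bar> \<le> amp * 1" by (intro mult_left_mono) (use amp_bounds in auto)
  then show ?thesis using amp_bounds by (simp add: abs_mult)
qed

lemma rho_bounds: "0 < rho s" "rho s < 1"
  using amp_sin[of "2 * s"] amp_bounds by (auto simp: rho_def abs_le_iff)

lemma radicand_pos:
  assumes "0 < r" "r < 1"
  shows "0 < m + (1 - 2 * l) * r"
proof -
  have "(2 * l - 1) * r \<le> (2 * l - 1) * 1" using l_ge assms by (intro mult_left_mono) auto
  then show ?thesis using l_less by (simp add: algebra_simps)
qed

lemma rho_periodic: "rho (s + pi) = rho s"
proof -
  have "sin (2 * (s + pi)) = sin (2 * s + 2 * pi)" by (simp add: algebra_simps)
  then show ?thesis by (simp add: rho_def)
qed

lemma DERIV_rho: "(rho has_real_derivative 2 * amp * cos (2 * s)) (at s)"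
  unfolding rho_def by (auto intro!: derivative_eq_intros)

lemma DERIV_rho': "((\<lambda>s. 2 * amp * cos (2 * s)) has_real_derivative 4 * (l - rho s)) (at s)"
  unfolding rho_def by (auto intro!: derivative_eq_intros)

text \<open>The first integral of \<open>\<rho>'' = 4 (l - \<rho>)\<close>.\<close>

lemma rho'_square: "(2 * amp * cos (2 * s))\<^sup>2 = 4 * (2 * l * rho s - (rho s)\<^sup>2 - m)"
proof -
  have "(2 * amp * cos (2 * s))\<^sup>2 = 4 * (amp\<^sup>2 - (amp * sin (2 * s))\<^sup>2)"
    by (simp add: power_mult_distrib cos_squared_eq algebra_simps)
  also have "\<dots> = 4 * (l\<^sup>2 - m - (rho s - l)\<^sup>2)" unfolding amp_bounds(4) by (simp add: rho_def)
  finally show ?thesis by (simp add: power2_eq_square algebra_simps)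
qed

text \<open>The integrand of \<open>\<theta>\<close> depends on the parameter of the curve only through \<open>\<rho>\<close>. Recording this
  dependence lets \<open>\<theta>'\<close> be evaluated from the ambient coordinates, where \<open>\<rho>\<close> is a sum of squares.\<close>

definition speed :: "real \<Rightarrow> real" where
  "speed r = sqrt (m + (1 - 2 * l) * r) / (sqrt r * (1 - r))"

lemma speed_pos: "0 < speed (rho s)"
  using rho_bounds[of s] radicand_pos[of "rho s"] by (simp add: speed_def)

lemma continuous_rho: "continuous_on A rho"
  unfolding rho_def by (intro continuous_intros)

lemma continuous_speed: "continuous_on A (\<lambda>s. speed (rho s))"
  unfolding speed_def using rho_bounds 
  by (intro continuous_intros continuous_rho) (auto simp: less_le)

lemma theta_eq: "theta m l s = (LBINT \<sigma>=0..ereal s. speed (rho \<sigma>))"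
  unfolding theta_def speed_def f_eq using rho_bounds by (simp add: less_imp_le)

lemma DERIV_theta: "(theta m l has_real_derivative speed (rho s)) (at s)"
proof -
  define b where "b = \<bar>s\<bar> + 1"
  have "((\<lambda>u. LBINT y=ereal 0..u. speed (rho y)) has_vector_derivative speed (rho s)) (at s within {-b..b})"
    by (rule interval_integral_FTC2) (auto simp: b_def continuous_speed)
  then have "((\<lambda>u. LBINT y=ereal 0..u. speed (rho y)) has_vector_derivative speed (rho s)) (at s)"
    by (subst (asm) at_within_interior) (auto simp: b_def)
  then show ?thesis by (simp add: theta_eq[abs_def] has_real_derivative_iff_has_vector_derivative zero_ereal_def)
qed

lemma theta_0: "theta m l 0 = 0"
  by (simp add: theta_def zero_ereal_def)

lemma theta_strict_mono: "x < y \<Longrightarrow> theta m l x < theta m l y"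
  by (rule DERIV_pos_imp_increasing) (use DERIV_theta speed_pos in blast)+

lemma continuous_theta: "continuous_on A (theta m l)"
  by (intro continuous_at_imp_continuous_on ballI DERIV_isCont[OF DERIV_theta])

lemma theta_less_iff: "theta m l x < theta m l y \<longleftrightarrow> x < y"
  using theta_strict_mono by (metis less_asym linorder_neqE)

lemma theta_eq_iff: "theta m l x = theta m l y \<longleftrightarrow> x = y"
  using theta_less_iff by (metis less_irrefl linorder_neqE)

text \<open>Both sides have the same derivative, as \<open>\<theta>'\<close> is periodic.\<close>

lemma theta_shift: "theta m l (s + pi) = theta m l s + Theta m l"
proof -
  have "((\<lambda>s. theta m l (s + pi) - theta m l s) has_real_derivative 0) (at s)" for s
  proof -
    have "((\<lambda>s. theta m l (s + pi)) has_real_derivative speed (rho s)) (at s)"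
      using DERIV_theta[of "s + pi"] DERIV_shift[of "theta m l" _ s pi] by (simp add: rho_periodic)
    from DERIV_diff[OF this DERIV_theta[of s]] show ?thesis by simp
  qed
  then have "theta m l (s + pi) - theta m l s = theta m l (0 + pi) - theta m l 0"
    using DERIV_isconst_all by blast
  then show ?thesis by (simp add: theta_0 Theta_def)
qed

end

locale closed_profile = rotational_profile +
  assumes Theta: "Theta m l = 2 * pi"
begin

lemma theta_shift_int: "theta m l (s + of_int n * pi) = theta m l s + 2 * pi * of_int n"
proof (induction n rule: int_induct[where k=0])
  case base
  then show ?case by simp
next
  case (step1 i)
  then show ?case using theta_shift[of "s + of_int i * pi"] Theta by (simp add: algebra_simps)
next
  case (step2 i)
  then show ?case using theta_shift[of "s + of_int (i - 1) * pi"] Theta by (simp add: algebra_simps)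
qed

lemma rho_shift_int: "rho (s + of_int n * pi) = rho s"
proof (induction n rule: int_induct[where k=0])
  case (step1 i)
  then show ?case using rho_periodic[of "s + of_int i * pi"] by (simp add: algebra_simps)
next
  case (step2 i)
  then show ?case using rho_periodic[of "s + of_int (i - 1) * pi"] by (simp add: algebra_simps)
qed simp

lemma theta_surj: "\<exists>s. theta m l s = a"
proof -
  define n where "n = \<lfloor>a / (2 * pi)\<rfloor>"
  have "of_int n \<le> a / (2 * pi)" "a / (2 * pi) \<le> of_int n + 1" unfolding n_def by linarith+
  then have n: "2 * pi * of_int n \<le> a" "a \<le> 2 * pi * of_int (n + 1)" by (simp_all add: field_simps)
  have "\<exists>x\<ge>of_int n * pi. x \<le> of_int (n + 1) * pi \<and> theta m l x = a"
    by (rule IVT') (use n theta_shift_int[of 0 n] theta_shift_int[of 0 "n + 1"] in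
        \<open>auto simp: theta_0 continuous_theta algebra_simps\<close>)
  then show ?thesis by blast
qed

definition theta_inv :: "real \<Rightarrow> real" where "theta_inv = inv (theta m l)"

lemma theta_inv [simp]: "theta m l (theta_inv a) = a" "theta_inv (theta m l s) = s"
proof -
  have "inj (theta m l)" "surj (theta m l)" using theta_eq_iff theta_surj by (auto simp: inj_def surj_def) metis
  then show "theta m l (theta_inv a) = a" "theta_inv (theta m l s) = s"
    unfolding theta_inv_def by (simp_all add: surj_f_inv_f)
qed

lemma isCont_theta_inv: "isCont theta_inv a"
proof -
  have "isCont theta_inv (theta m l (theta_inv a))"
    by (rule isCont_inverse_function[where d=1]) (auto simp: DERIV_isCont[OF DERIV_theta])
  then show ?thesis by simp
qed

lemma DERIV_theta_inv: "(theta_inv has_real_derivative 1 / speed (rho (theta_inv a))) (at a)"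
proof -
  have "(theta_inv has_real_derivative inverse (speed (rho (theta_inv a)))) (at a)"
    by (rule DERIV_inverse_function[where f="theta m l" and a="a - 1" and b="a + 1"])
      (use speed_pos[of "theta_inv a"] in \<open>auto simp: DERIV_theta isCont_theta_inv\<close>)
  then show ?thesis by (simp add: divide_inverse)
qed

text \<open>Equal angles differ by \<open>2 \<pi> n\<close>, so by strict monotonicity the parameters differ by \<open>\<pi> n\<close>, a
  period of \<open>\<rho>\<close>. This is the reason why the closed surface has no self-intersection.\<close>

lemma rho_eq_of_theta:
  assumes "cos (theta m l s) = cos (theta m l s')" "sin (theta m l s) = sin (theta m l s')"
  shows "rho s = rho s'"
proof -
  obtain n where "theta m l s = theta m l s' + 2 * pi * of_int n"
    using sin_cos_eq_iff assms by (metis mult.commute)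
  then have "theta m l s = theta m l (s' + of_int n * pi)" by (simp add: theta_shift_int)
  then show ?thesis by (simp add: theta_eq_iff rho_shift_int)
qed

end

section \<open>Closing the profile curve\<close>

lemma DERIV_arctan_quotient:
  assumes N: "(N has_real_derivative N') (at x)" and E: "(E has_real_derivative E') (at x)" and pos: "0 < E x"
  shows "((\<lambda>x. arctan (N x / E x)) has_real_derivative (N' * E x - N x * E') / ((E x)\<^sup>2 + (N x)\<^sup>2)) (at x)"
proof -
  have "((\<lambda>x. arctan (N x / E x)) has_real_derivative
      inverse (1 + (N x / E x)\<^sup>2) * ((N' * E x - N x * E') / (E x * E x))) (at x)"
    by (rule DERIV_chain2[OF DERIV_arctan DERIV_divide[OF N E]]) (use pos in simp)
  moreover have "inverse (1 + (N x / E x)\<^sup>2) = (E x * E x) / ((E x)\<^sup>2 + (N x)\<^sup>2)"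
    using pos by (simp add: field_simps power2_eq_square add_divide_distrib[symmetric])
  ultimately show ?thesis using pos by simp
qed

text \<open>The function is a continuous branch of the argument of \<open>b cos y + i a sin y\<close>: the product of that
  number with \<open>e\<^sup>-\<^sup>i\<^sup>y\<close> has positive real part, so its argument is an arctangent. Unlike
  \<open>arctan (a tan y / b)\<close> this antiderivative has no jumps, and it gives the integral over a full
  period at once.\<close>

lemma DERIV_ellipse_angle:
  assumes a: "0 < (a::real)" and b: "0 < b"
  shows "((\<lambda>y. y - arctan ((b - a) * (sin y * cos y) / (b * (cos y)\<^sup>2 + a * (sin y)\<^sup>2)))
     has_real_derivative a * b / (b\<^sup>2 * (cos y)\<^sup>2 + a\<^sup>2 * (sin y)\<^sup>2)) (at y)"
proof -
  have cs: "(sin y)\<^sup>2 + (cos y)\<^sup>2 = 1" by simp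
  have pos: "0 < b * (cos y)\<^sup>2 + a * (sin y)\<^sup>2" "0 < b\<^sup>2 * (cos y)\<^sup>2 + a\<^sup>2 * (sin y)\<^sup>2" if "0 < a" "0 < b" for a b
    using cs that by (metis add.commute add_cancel_right_left add_nonneg_eq_0_iff add_pos_nonneg less_eq_real_def mult_eq_0_iff
        mult_nonneg_nonneg power_not_zero zero_le_power2 zero_neq_one less_irrefl)+
  have N: "((\<lambda>y. (b - a) * (sin y * cos y)) has_real_derivative (b - a) * ((cos y)\<^sup>2 - (sin y)\<^sup>2)) (at y)"
    by (auto intro!: derivative_eq_intros simp: power2_eq_square algebra_simps)
  have E: "((\<lambda>y. b * (cos y)\<^sup>2 + a * (sin y)\<^sup>2) has_real_derivative 2 * (a - b) * (sin y * cos y)) (at y)"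
    by (auto intro!: derivative_eq_intros simp: algebra_simps)
  have num: "(b - a) * ((cos y)\<^sup>2 - (sin y)\<^sup>2) * (b * (cos y)\<^sup>2 + a * (sin y)\<^sup>2)
      - (b - a) * (sin y * cos y) * (2 * (a - b) * (sin y * cos y))
     = (b - a) * (b * (cos y)\<^sup>2 - a * (sin y)\<^sup>2)"
    using cs by algebra
  have den: "(b * (cos y)\<^sup>2 + a * (sin y)\<^sup>2)\<^sup>2 + ((b - a) * (sin y * cos y))\<^sup>2 = b\<^sup>2 * (cos y)\<^sup>2 + a\<^sup>2 * (sin y)\<^sup>2"
    using cs by algebra
  have fin: "1 - (b - a) * (b * (cos y)\<^sup>2 - a * (sin y)\<^sup>2) / (b\<^sup>2 * (cos y)\<^sup>2 + a\<^sup>2 * (sin y)\<^sup>2)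
      = a * b / (b\<^sup>2 * (cos y)\<^sup>2 + a\<^sup>2 * (sin y)\<^sup>2)"
  proof -
    have "b\<^sup>2 * (cos y)\<^sup>2 + a\<^sup>2 * (sin y)\<^sup>2 - (b - a) * (b * (cos y)\<^sup>2 - a * (sin y)\<^sup>2) = a * b"
      using cs by algebra
    then show ?thesis using pos(2)[OF a b] by (simp add: field_simps)
  qed
  show ?thesis
    using DERIV_diff[OF DERIV_ident DERIV_arctan_quotient[OF N E pos(1)[OF a b]]]
    unfolding num den fin .
qed

context rotational_profile
begin

text \<open>Bounds for the period are proved by comparing \<open>\<theta>\<close> with an explicit antiderivative, here from
  above and in \<open>theta_diff_ge\<close> from below.\<close>

lemma theta_diff_le:
  assumes "x \<le> y" and P: "\<And>s. x \<le> s \<Longrightarrow> s \<le> y \<Longrightarrow> \<exists>d. (P has_real_derivative d) (at s) \<and> speed (rho s) \<le> d"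
  shows "theta m l y - theta m l x \<le> P y - P x"
proof -
  have "P x - theta m l x \<le> P y - theta m l y"
  proof (rule DERIV_nonneg_imp_nondecreasing[OF assms(1)])
    fix s assume "x \<le> s" "s \<le> y"
    then obtain d where "(P has_real_derivative d) (at s)" "speed (rho s) \<le> d" using P by blast
    then show "\<exists>D. ((\<lambda>s. P s - theta m l s) has_real_derivative D) (at s) \<and> 0 \<le> D"
      by (intro exI[of _ "d - speed (rho s)"]) (auto intro: DERIV_diff DERIV_theta)
  qed
  then show ?thesis by simp
qed

lemma theta_diff_ge:
  assumes "x \<le> y" and P: "\<And>s. x \<le> s \<Longrightarrow> s \<le> y \<Longrightarrow> \<exists>d. (P has_real_derivative d) (at s) \<and> d \<le> speed (rho s)"
  shows "P y - P x \<le> theta m l y - theta m l x"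
proof -
  have "theta m l x - P x \<le> theta m l y - P y"
  proof (rule DERIV_nonneg_imp_nondecreasing[OF assms(1)])
    fix s assume "x \<le> s" "s \<le> y"
    then obtain d where "(P has_real_derivative d) (at s)" "d \<le> speed (rho s)" using P by blast
    then show "\<exists>D. ((\<lambda>s. theta m l s - P s) has_real_derivative D) (at s) \<and> 0 \<le> D"
      by (intro exI[of _ "speed (rho s) - d"]) (auto intro: DERIV_diff DERIV_theta)
  qed
  then show ?thesis by simp
qed

lemma Theta_integral: "Theta m l = integral {0..pi} (\<lambda>s. speed (rho s))"
proof -
  have "((\<lambda>s. speed (rho s)) has_integral theta m l pi - theta m l 0) {0..pi}"
    by (rule fundamental_theorem_of_calculus)
      (auto intro: has_vector_derivative_at_within DERIV_theta[unfolded has_real_derivative_iff_has_vector_derivative])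
  then show ?thesis by (simp add: theta_0 Theta_def integral_unique)
qed

text \<open>The amplitude vanishes, so \<open>\<theta>' = 1 / sqrt (1 - l)\<close> is constant, and \<open>l = sqrt m < 3/4\<close>.\<close>

lemma Theta_lower_end:
  assumes "l = sqrt m" "m < 9/16"
  shows "Theta m l < 2 * pi"
proof -
  have lm: "l\<^sup>2 = m" using assms m_pos by simp
  have "sqrt m < sqrt ((3/4)\<^sup>2)" using assms by (simp only: real_sqrt_less_iff) (simp add: power2_eq_square)
  then have l34: "l < 3/4" using assms by simp
  have rho: "rho s = l" for s unfolding rho_def lm by simp
  have l0: "0 < l" using l_ge by simp
  have "m + (1 - 2 * l) * l = l * (1 - l)" unfolding lm[symmetric] by (simp add: power2_eq_square algebra_simps)
  then have "speed l = sqrt l * sqrt (1 - l) / (sqrt l * (sqrt (1 - l) * sqrt (1 - l)))"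
    unfolding speed_def using l34 by (simp add: real_sqrt_mult)
  also have "\<dots> = 1 / sqrt (1 - l)" 
  proof -
    have "u * v / (u * (v * v)) = 1 / v" if "u \<noteq> 0" "v \<noteq> 0" for u v :: real
      using that by simp
    moreover have "sqrt l \<noteq> 0" "sqrt (1 - l) \<noteq> 0" using l0 l34 by simp_all
    ultimately show ?thesis by blast
  qed
  also have "\<dots> < 2"
  proof -
    have "1/2 < sqrt (1 - l)" using l34 by (intro real_less_rsqrt) (simp add: power2_eq_square)
    moreover have "0 < sqrt (1 - l)" using l34 by simp
    ultimately show ?thesis by (simp add: divide_less_eq)
  qed
  finally have sp: "speed l < 2" .
  have "theta m l pi - theta m l 0 \<le> speed l * pi - speed l * 0"
  proof (rule theta_diff_le)
    show "\<exists>d. ((*) (speed l) has_real_derivative d) (at s) \<and> speed (rho s) \<le> d" for s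
      unfolding rho by (intro exI[of _ "speed l"]) (auto intro!: derivative_eq_intros)
  qed simp
  also have "\<dots> < 2 * pi" using sp by simp
  finally show ?thesis by (simp add: theta_0 Theta_def)
qed

text \<open>With \<open>y = 2 s\<close> and \<open>a = sqrt m\<close> one has \<open>\<rho> (1 - \<rho>) = a\<^sup>2 sin\<^sup>2 y + cos\<^sup>2 y / 4\<close>, so
  \<open>\<theta>' = a sqrt \<rho> / (\<rho> (1 - \<rho>))\<close> would be integrable in closed form without the factor \<open>sqrt \<rho>\<close>. The
  tangent line of the square root at \<open>1/2\<close> bounds this factor by \<open>(\<rho> + 1/2) / sqrt 2\<close>. The resulting
  odd part has a periodic antiderivative, so the bound for the period is \<open>sqrt 2 \<pi>\<close>.\<close>

lemma Theta_at_half: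
  assumes "l = 1/2" 
  shows "Theta m l < 2 * pi"
proof -
  define a where "a = sqrt m"
  (* The first arctangent belongs to the even part 1 / Q of the bound, the second one to the odd part
     sin y / Q; both are periodic. *)
  define P where "P s = (let y = 2 * s in
      (y - arctan ((1/2 - a) * (sin y * cos y) / (1/2 * (cos y)\<^sup>2 + a * (sin y)\<^sup>2)))
      - arctan (amp * cos y / a) / 2) / sqrt 2" for s
  have a: "0 < a" "a\<^sup>2 = m" using m_pos by (auto simp: a_def)
  have "l\<^sup>2 - m = 1/4 - a\<^sup>2" unfolding a(2) assms by (simp add: power2_eq_square)
  then have amp2: "amp\<^sup>2 = 1/4 - a\<^sup>2" using amp_bounds(4) by linarith
  have "theta m l pi - theta m l 0 \<le> P pi - P 0"
  proof (rule theta_diff_le)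
    fix s :: real
    define y where "y = 2 * s"
    define Q where "Q = (1/2)\<^sup>2 * (cos y)\<^sup>2 + a\<^sup>2 * (sin y)\<^sup>2"
    define d where "d = (2 * (a * (1/2) / Q) + amp * a * sin y / Q) / sqrt 2"
    have cs: "(sin y)\<^sup>2 + (cos y)\<^sup>2 = 1" by simp
    have rho_s: "rho s = 1/2 + amp * sin y" unfolding rho_def y_def using assms by simp
    have Q1: "Q = rho s * (1 - rho s)"
    proof -
      have "rho s * (1 - rho s) = 1/4 - amp\<^sup>2 * (sin y)\<^sup>2"
        unfolding rho_s by (simp add: power2_eq_square algebra_simps)
      then show ?thesis unfolding amp2 Q_def using cs by algebra
    qed
    then have Qpos: "0 < Q" using rho_bounds[of s] by simp
    have Q2: "Q = a\<^sup>2 + (amp * cos y)\<^sup>2" unfolding power_mult_distrib amp2 Q_def using cs by algebra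
    have y: "((\<lambda>s. 2 * s) has_real_derivative 2) (at s)" by (auto intro!: derivative_eq_intros)
    have 1: "((\<lambda>s. (2 * s - arctan ((1/2 - a) * (sin (2 * s) * cos (2 * s)) / (1/2 * (cos (2 * s))\<^sup>2 + a * (sin (2 * s))\<^sup>2))))
      has_real_derivative a * (1/2) / Q * 2) (at s)"
      using DERIV_chain2[OF DERIV_ellipse_angle[OF a(1), of "1/2" "2 * s"] y] unfolding Q_def y_def by simp
    have "((\<lambda>s. amp * cos (2 * s)) has_real_derivative - 2 * amp * sin y) (at s)"
      unfolding y_def by (auto intro!: derivative_eq_intros)
    from DERIV_arctan_quotient[OF this DERIV_const[of a] a(1)]
    have 2: "((\<lambda>s. arctan (amp * cos (2 * s) / a)) has_real_derivative - 2 * amp * sin y * a / Q) (at s)"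
      unfolding Q2 y_def by simp
    have dP: "(P has_real_derivative d) (at s)"
      using DERIV_cdivide[OF DERIV_diff[OF 1 DERIV_cdivide[OF 2, of 2]], of "sqrt 2"]
      unfolding P_def Let_def d_def by (simp add: algebra_simps)
    have r: "0 < rho s" "rho s < 1" using rho_bounds by auto
    have "speed (rho s) = a * sqrt (rho s) / Q"
      unfolding speed_def Q1 a_def using r by (simp add: assms field_simps) 
    also have "\<dots> \<le> a * ((rho s + 1/2) / sqrt 2) / Q"
    proof -
      have "0 \<le> (sqrt (rho s) * sqrt 2 - 1)\<^sup>2" by simp
      also have "\<dots> = rho s * 2 - 2 * (sqrt (rho s) * sqrt 2) + 1"
        using r by (simp add: power2_diff power_mult_distrib)
      finally have "sqrt (rho s) * sqrt 2 \<le> rho s + 1/2" by simp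
      then have "sqrt (rho s) \<le> (rho s + 1/2) / sqrt 2" by (simp add: field_simps)
      then show ?thesis using a Qpos by (intro divide_right_mono mult_left_mono) auto
    qed
    also have "\<dots> = d"
      unfolding d_def rho_s using Qpos by (simp add: field_simps)
    finally show "\<exists>d. (P has_real_derivative d) (at s) \<and> speed (rho s) \<le> d" using dP by blast
  qed simp
  also have "P pi - P 0 = 2 * pi / sqrt 2" by (simp add: P_def diff_divide_distrib)
  also have "\<dots> < 2 * pi" by (simp add: field_simps)
  finally show ?thesis by (simp add: theta_0 Theta_def)
qed

text \<open>The maximum of \<open>\<rho>\<close> is at \<open>\<pi>/4\<close>. At distance \<open>x\<close> from it, \<open>1 - \<rho>\<close> is at most \<open>e\<^sup>2 + x\<^sup>2\<close> with
  \<open>e\<^sup>2 = 1 - l - amp\<close> its minimum. Hence \<open>\<theta>' \<ge> sqrt m / (e + x)\<close>, whose integral over \<open>[0, 1]\<close> grows like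
  \<open>- ln e\<close>.\<close>

lemma Theta_lower_bound: "sqrt m * ln (1 / sqrt (1 - l - amp)) \<le> Theta m l"
proof -
  define e where "e = sqrt (1 - l - amp)"
  have e: "0 < e" "e\<^sup>2 = 1 - l - amp" using amp_bounds by (auto simp: e_def)
  define P where "P s = sqrt m * ln (e + (s - pi / 4))" for s
  have "P (pi / 4 + 1) - P (pi / 4) \<le> theta m l (pi / 4 + 1) - theta m l (pi / 4)"
  proof (rule theta_diff_ge)
    fix s assume s: "pi / 4 \<le> s" "s \<le> pi / 4 + 1"
    define x where "x = s - pi / 4"
    have x: "0 \<le> x" using s by (simp add: x_def)
    have dP: "(P has_real_derivative sqrt m / (e + x)) (at s)"
      unfolding P_def x_def using e s by (auto intro!: derivative_eq_intros)
    have r: "0 < rho s" "rho s < 1" using rho_bounds by auto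
    have "sin (2 * s) = cos (2 * x)"
      unfolding x_def by (simp add: cos_diff right_diff_distrib)
    then have sn: "sin (2 * s) = 1 - 2 * (sin x)\<^sup>2" by (simp add: cos_double_sin)
    have "(sin x)\<^sup>2 \<le> x\<^sup>2" using sin_x_le_x[OF x] abs_sin_x_le_abs_x[of x] by (simp add: abs_le_square_iff)
    moreover have "amp * (2 * (sin x)\<^sup>2) \<le> 1/2 * (2 * (sin x)\<^sup>2)"
      using amp_bounds l_ge by (intro mult_right_mono) auto
    ultimately have "1 - rho s \<le> e\<^sup>2 + x\<^sup>2"
      unfolding rho_def sn e(2) by (simp add: algebra_simps)
    also have "\<dots> \<le> (e + x)\<^sup>2" using e x by (simp add: power2_sum)
    finally have "sqrt (1 - rho s) \<le> sqrt ((e + x)\<^sup>2)" by (rule real_sqrt_le_mono)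
    then have 1: "sqrt (1 - rho s) \<le> e + x" using e x by simp
    have "sqrt m / (e + x) \<le> sqrt m / sqrt (1 - rho s)"
      using 1 r m_pos by (intro divide_left_mono) (auto intro!: mult_pos_pos simp: add_pos_nonneg e x)
    also have "\<dots> \<le> sqrt m / (sqrt (1 - rho s) * sqrt (rho s))"
      using r m_pos by (intro divide_left_mono) (auto intro!: mult_left_le)
    also have "\<dots> = sqrt (m * (1 - rho s)) / (sqrt (rho s) * (sqrt (1 - rho s) * sqrt (1 - rho s)))"
    proof -
      have "u / (v * w) = u * v / (w * (v * v))" if "v \<noteq> 0" for u v w :: real
        using that by simp
      from this[of "sqrt (1 - rho s)" "sqrt m" "sqrt (rho s)"] show ?thesis
        unfolding real_sqrt_mult using r by simp
    qed
    also have "\<dots> = sqrt (m * (1 - rho s)) / (sqrt (rho s) * (1 - rho s))" using r by simp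
    also have "\<dots> \<le> speed (rho s)"
    proof -
      have "0 \<le> (m + 1 - 2 * l) * rho s" using r l_less by simp
      then have "m * (1 - rho s) \<le> m + (1 - 2 * l) * rho s" by (simp add: algebra_simps)
      then show ?thesis unfolding speed_def using r by (intro divide_right_mono) auto
    qed
    finally show "\<exists>d. (P has_real_derivative d) (at s) \<and> d \<le> speed (rho s)" using dP by blast
  qed simp
  moreover have "theta m l (pi / 4 + 1) \<le> theta m l pi" "theta m l 0 \<le> theta m l (pi / 4)"
    using theta_less_iff pi_gt3 by (simp_all add: not_less[symmetric])
  moreover have "sqrt m * ln (1 / e) \<le> P (pi / 4 + 1) - P (pi / 4)"
  proof -
    have "ln (1 / e) = 0 - ln e" using e by (simp add: ln_div)
    also have "\<dots> \<le> ln (e + 1) - ln e" using e by simp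
    finally have "sqrt m * ln (1 / e) \<le> sqrt m * (ln (e + 1) - ln e)"
      using m_pos by (intro mult_left_mono) auto
    then show ?thesis by (simp add: P_def right_diff_distrib)
  qed
  ultimately show ?thesis unfolding e_def[symmetric] by (simp add: theta_0 Theta_def)
qed

end

lemma continuous_on_Theta:
  assumes prof: "\<And>l. l \<in> A \<Longrightarrow> rotational_profile m l"
  shows "continuous_on A (Theta m)"
proof -
  let ?r = "\<lambda>l s. l + sqrt (l\<^sup>2 - m) * sin (2 * s)"
  let ?g = "\<lambda>l s. sqrt (m + (1 - 2 * l) * ?r l s) / (sqrt (?r l s) * (1 - ?r l s))"
  have "continuous_on (A \<times> cbox 0 pi) (\<lambda>(l, s). ?g l s)"
  proof -
    have "0 < ?r l s" "?r l s < 1" if "l \<in> A" for l s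
      using rotational_profile.rho_bounds[OF prof[OF that], of s]
      unfolding rotational_profile.rho_def[OF prof[OF that]] by auto
    then show ?thesis unfolding case_prod_beta
      by (intro continuous_intros) (force simp: less_le)
  qed
  then have "continuous_on A (\<lambda>l. integral (cbox 0 pi) (?g l))"
    by (rule integral_continuous_on_param)
  moreover have "integral (cbox 0 pi) (?g l) = Theta m l" if "l \<in> A" for l
    using rotational_profile.Theta_integral[OF prof[OF that]]
    unfolding rotational_profile.rho_def[OF prof[OF that]] rotational_profile.speed_def[OF prof[OF that]]
    by simp
  ultimately show ?thesis by (simp cong: continuous_on_cong)
qed

lemma exists_closing_parameter:
  fixes m :: real
  assumes m: "0 < m" "m < 9/16"
  shows "\<exists>l. 1/2 < l \<and> sqrt m < l \<and> l < (m + 1) / 2 \<and> Theta m l = 2 * pi"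
proof -
  define L where "L = max (sqrt m) (1/2)"
  define R where "R = (m + 1) / 2"
  have "0 < (1 - sqrt m)\<^sup>2" using m by (simp add: zero_less_power2)
  then have "sqrt m < (m + 1) / 2" using m by (simp add: power2_diff)
  then have LR: "L < R" using m by (auto simp: L_def R_def)
  have prof: "rotational_profile m l" if "L \<le> l" "l < R" for l
    using that m by unfold_locales (auto simp: L_def R_def)
  have low: "Theta m L < 2 * pi"
  proof (cases "sqrt m \<le> 1/2")
    case True
    then have "L = 1/2" by (simp add: L_def)
    then show ?thesis using rotational_profile.Theta_at_half[OF prof[OF order_refl LR]] by simp
  next
    case False
    then have "L = sqrt m" by (simp add: L_def)
    then show ?thesis using rotational_profile.Theta_lower_end[OF prof[OF order_refl LR]] m by simp
  qed
  (* The logarithmic lower bound exceeds 2 pi as soon as 1 - l - amp is below B. *)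
  define B where "B = exp (- 2 * (2 * pi) / sqrt m)"
  have "((\<lambda>l. 1 - l - sqrt (l\<^sup>2 - m)) \<longlongrightarrow> 1 - R - sqrt (R\<^sup>2 - m)) (at_left R)"
    by (intro tendsto_intros)
  moreover have "1 - R - sqrt (R\<^sup>2 - m) = 0"
  proof -
    have "R\<^sup>2 - m = ((1 - m) / 2)\<^sup>2" by (simp add: R_def power2_eq_square field_simps)
    then have "sqrt (R\<^sup>2 - m) = (1 - m) / 2" using m by (simp only: real_sqrt_abs) simp
    then show ?thesis by (simp add: R_def field_simps)
  qed
  ultimately have "\<forall>\<^sub>F l in at_left R. 1 - l - sqrt (l\<^sup>2 - m) < B"
    by (intro order_tendstoD) (auto simp: B_def)
  moreover have "\<forall>\<^sub>F l in at_left R. L < l \<and> l < R"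
    using eventually_at_left_real[OF LR] by eventually_elim auto
  ultimately have "\<forall>\<^sub>F l in at_left R. 1 - l - sqrt (l\<^sup>2 - m) < B \<and> L < l \<and> l < R"
    by eventually_elim auto
  from eventually_happens[OF this] obtain l1 where l1: "1 - l1 - sqrt (l1\<^sup>2 - m) < B" "L < l1" "l1 < R"
    by auto
  interpret l1: rotational_profile m l1 using prof l1 by simp
  define e where "e = 1 - l1 - sqrt (l1\<^sup>2 - m)"
  have e: "0 < e" using l1.amp_bounds by (simp add: e_def)
  have "0 < B" "e < B" using l1(1) by (simp_all add: e_def B_def)
  then have "ln e < ln B" using e by simp
  then have "ln e < - 2 * (2 * pi) / sqrt m" by (simp add: B_def)
  then have "2 * (2 * pi) < - ln e * sqrt m" using m by (simp add: field_simps)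
  moreover have "ln (1 / sqrt e) = - ln e / 2" using e by (simp add: ln_div ln_sqrt)
  ultimately have "2 * pi < sqrt m * ln (1 / sqrt e)" by (simp add: mult.commute)
  then have high: "2 * pi < Theta m l1" using l1.Theta_lower_bound by (simp add: e_def)
  have "\<exists>l\<ge>L. l \<le> l1 \<and> Theta m l = 2 * pi"
    by (rule IVT') (use low high l1 prof in \<open>auto intro!: continuous_on_Theta\<close>)
  then obtain l where "L \<le> l" "l \<le> l1" "Theta m l = 2 * pi" by blast
  moreover have "l \<noteq> L" using calculation low by auto
  ultimately show ?thesis using l1 by (intro exI[of _ l]) (auto simp: L_def R_def)
qed

section \<open>Polar angle near a given direction\<close>

text \<open>The branch of the argument of \<open>x + i y\<close> with values within \<open>\<pi>/2\<close> of \<open>a\<close>, meaningful on the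
  open half plane around the direction \<open>a\<close>.\<close>

definition polar_angle :: "real \<Rightarrow> real \<Rightarrow> real \<Rightarrow> real" where
  "polar_angle a x y = a + arctan ((y * cos a - x * sin a) / (x * cos a + y * sin a))"

lemma polar_angle_recover:
  assumes "0 < x * cos a + y * sin a"
  shows "x = sqrt (x\<^sup>2 + y\<^sup>2) * cos (polar_angle a x y)" "y = sqrt (x\<^sup>2 + y\<^sup>2) * sin (polar_angle a x y)"
proof -
  define u where "u = x * cos a + y * sin a"
  define v where "v = y * cos a - x * sin a"
  have u: "0 < u" using assms by (simp add: u_def)
  have cs: "(sin a)\<^sup>2 + (cos a)\<^sup>2 = 1" by simp
  have uv: "u\<^sup>2 + v\<^sup>2 = x\<^sup>2 + y\<^sup>2" unfolding u_def v_def using cs by algebra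
  have "1 + (v / u)\<^sup>2 = (u\<^sup>2 + v\<^sup>2) / u\<^sup>2" using u by (simp add: field_simps)
  then have q: "sqrt (1 + (v / u)\<^sup>2) = sqrt (u\<^sup>2 + v\<^sup>2) / u" using u by (simp add: real_sqrt_divide)
  have r: "0 < sqrt (u\<^sup>2 + v\<^sup>2)" using u by (simp add: add_pos_nonneg)
  have c: "sqrt (u\<^sup>2 + v\<^sup>2) * cos (arctan (v / u)) = u" unfolding cos_arctan q using u r by simp
  have s: "sqrt (u\<^sup>2 + v\<^sup>2) * sin (arctan (v / u)) = v" unfolding sin_arctan q using u r by simp
  have "sqrt (x\<^sup>2 + y\<^sup>2) * cos (polar_angle a x y) = cos a * u - sin a * v"
    unfolding polar_angle_def u_def[symmetric] v_def[symmetric] uv[symmetric] cos_add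
    using c s by (simp add: right_diff_distrib mult.left_commute)
  also have "\<dots> = x" unfolding u_def v_def using cs by algebra
  finally show "x = sqrt (x\<^sup>2 + y\<^sup>2) * cos (polar_angle a x y)" ..
  have "sqrt (x\<^sup>2 + y\<^sup>2) * sin (polar_angle a x y) = sin a * u + cos a * v"
    unfolding polar_angle_def u_def[symmetric] v_def[symmetric] uv[symmetric] sin_add
    using c s by (simp add: distrib_left mult.left_commute)
  also have "\<dots> = y" unfolding u_def v_def using cs by algebra
  finally show "y = sqrt (x\<^sup>2 + y\<^sup>2) * sin (polar_angle a x y)" ..
qed

lemma polar_angle_polar:
  assumes "0 < r" "\<bar>b - a\<bar> < pi / 2"
  shows "0 < r * cos b * cos a + r * sin b * sin a" "polar_angle a (r * cos b) (r * sin b) = b"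
proof -
  have c: "r * cos b * cos a + r * sin b * sin a = r * cos (b - a)" by (simp add: cos_diff distrib_left)
  have s: "r * sin b * cos a - r * cos b * sin a = r * sin (b - a)" by (simp add: sin_diff right_diff_distrib)
  have cp: "0 < cos (b - a)" using assms(2) by (intro cos_gt_zero_pi) linarith+
  show "0 < r * cos b * cos a + r * sin b * sin a" unfolding c using assms(1) cp by simp
  have "r * sin (b - a) / (r * cos (b - a)) = tan (b - a)" using assms by (simp add: tan_def)
  moreover have "arctan (tan (b - a)) = b - a" using assms(2) by (intro arctan_tan) linarith+
  ultimately show "polar_angle a (r * cos b) (r * sin b) = b" unfolding polar_angle_def c s by simp
qed

lemma polar_angle_near: "\<bar>polar_angle a x y - a\<bar> < pi / 2"
  unfolding polar_angle_def using arctan_bounded[of "(y * cos a - x * sin a) / (x * cos a + y * sin a)"] by (auto simp: abs_less_iff)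

lemma Ck_on_polar_angle:
  fixes x y :: "real^2 \<Rightarrow> real"
  assumes U: "open U" and x: "Ck_on k U x" and y: "Ck_on k U y"
    and pos: "\<And>p. p \<in> U \<Longrightarrow> 0 < x p * cos a + y p * sin a"
  shows "Ck_on k U (\<lambda>p. polar_angle a (x p) (y p))"
proof -
  have nz: "\<And>p. p \<in> U \<Longrightarrow> x p * cos a + y p * sin a \<noteq> 0" using pos by force
  show ?thesis unfolding polar_angle_def divide_inverse
    by (intro Ck_on_add[OF U] Ck_on_const Ck_on_arctan[OF U] Ck_on_mult[OF U] Ck_on_diff[OF U]
        Ck_on_inverse[OF U nz] x y)
qed

section \<open>The rotational torus\<close>

lemma vector_4:
  "(vector [x,y,z,w] ::('a::zero)^4) $ 1 = x"
  "(vector [x,y,z,w] ::('a::zero)^4) $ 2 = y"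
  "(vector [x,y,z,w] ::('a::zero)^4) $ 3 = z"
  "(vector [x,y,z,w] ::('a::zero)^4) $ 4 = w"
  unfolding vector_def by simp_all

lemma vec_eq_iff_2: "(u :: 'a^2) = v \<longleftrightarrow> u $ 1 = v $ 1 \<and> u $ 2 = v $ 2"
  by (simp add: vec_eq_iff forall_2)

lemma vec_eq_iff_4: "(u :: 'a^4) = v \<longleftrightarrow> u $ 1 = v $ 1 \<and> u $ 2 = v $ 2 \<and> u $ 3 = v $ 3 \<and> u $ 4 = v $ 4"
  by (simp add: vec_eq_iff forall_4)

context rotational_profile
begin

lemma X_component:
  "X m l p $ 1 = sqrt (1 - rho (p $ 1)) * cos (theta m l (p $ 1))"
  "X m l p $ 2 = sqrt (1 - rho (p $ 1)) * sin (theta m l (p $ 1))"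
  "X m l p $ 3 = sqrt (rho (p $ 1)) * cos (p $ 2)"
  "X m l p $ 4 = sqrt (rho (p $ 1)) * sin (p $ 2)"
  using rho_bounds[of "p $ 1"] by (simp_all add: X_def Let_def vector_4 f_eq)

lemma X_radii:
  "(X m l p $ 1)\<^sup>2 + (X m l p $ 2)\<^sup>2 = 1 - rho (p $ 1)"
  "(X m l p $ 3)\<^sup>2 + (X m l p $ 4)\<^sup>2 = rho (p $ 1)"
  using rho_bounds[of "p $ 1"]
  by (simp_all add: X_component power_mult_distrib distrib_left[symmetric])

lemma X_in_sphere: "X m l p \<in> sphere 0 1"
proof -
  have "X m l p \<bullet> X m l p = (X m l p $ 1)\<^sup>2 + (X m l p $ 2)\<^sup>2 + ((X m l p $ 3)\<^sup>2 + (X m l p $ 4)\<^sup>2)"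
    by (simp add: inner_vec_def sum_4 power2_eq_square)
  also have "\<dots> = 1" unfolding X_radii by simp
  finally show ?thesis by (simp add: norm_eq_sqrt_inner)
qed

lemma smooth_on_theta: "smooth_on UNIV (\<lambda>p::real^2. theta m l (p $ 1))"
  and Ck_on_rho: "Ck_on k UNIV (\<lambda>p::real^2. rho (p $ 1))"
proof -
  have rho: "Ck_on k UNIV (\<lambda>p::real^2. rho (p $ 1))" for k unfolding rho_def
    by (intro Ck_on_add Ck_on_mult Ck_on_const Ck_on_coordinate open_UNIV
        Ck_on_sin_cos[THEN conjunct1])
  then show "Ck_on k UNIV (\<lambda>p::real^2. rho (p $ 1))" .
  have s: "((\<lambda>p::real^2. p $ 1) has_derivative (\<lambda>h. h $ 1)) (at p)" for p
    by (rule bounded_linear_imp_has_derivative[OF bounded_linear_vec_nth])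
  show "smooth_on UNIV (\<lambda>p::real^2. theta m l (p $ 1))"
  proof (rule smooth_on_I)
    fix p :: "real^2" and i :: 2
    have *: "pd i (\<lambda>p. theta m l (p $ 1)) q = speed (rho (q $ 1)) * (axis i 1 :: real^2) $ 1"
      "(\<lambda>p. theta m l (p $ 1)) differentiable (at q)" for q
    proof -
      have "(\<lambda>p::real^2. p $ 1) differentiable (at q)" using s unfolding differentiable_def by blast
      note d = pd_comp[OF DERIV_theta this]
      show "(\<lambda>p. theta m l (p $ 1)) differentiable (at q)" by (rule d(2))
      show "pd i (\<lambda>p. theta m l (p $ 1)) q = speed (rho (q $ 1)) * (axis i 1 :: real^2) $ 1"
        unfolding d(1) pd_eqI[OF s] ..
    qed
    then show "(\<lambda>p. theta m l (p $ 1)) differentiable (at p)" by blast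
    have "smooth_on UNIV (\<lambda>p. speed (rho (p $ 1)) * (axis i 1 :: real^2) $ 1)"
      unfolding smooth_on_def speed_def divide_inverse
      by (intro allI Ck_on_mult Ck_on_inverse Ck_on_sqrt Ck_on_add Ck_on_diff Ck_on_const rho open_UNIV)
        (use rho_bounds radicand_pos in \<open>auto simp: less_le\<close>)
    moreover have "pd i (\<lambda>p. theta m l (p $ 1)) = (\<lambda>p. speed (rho (p $ 1)) * (axis i 1 :: real^2) $ 1)"
      by (rule ext) (rule *(1))
    ultimately show "smooth_on UNIV (pd i (\<lambda>p. theta m l (p $ 1)))" by simp
  qed
qed

lemma smooth_on_X: "open U \<Longrightarrow> smooth_on U (X m l)"
proof -
  have th: "Ck_on k UNIV (\<lambda>p::real^2. theta m l (p $ 1))" for k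
    using smooth_on_theta by (simp add: smooth_on_def)
  have "Ck_on k UNIV (\<lambda>p. X m l p $ j)" for k j
    using exhaust_4[of j]
    by (elim disjE; simp only: X_component)
      (intro Ck_on_mult Ck_on_sqrt Ck_on_diff Ck_on_const Ck_on_rho open_UNIV
        Ck_on_sin_cos[THEN conjunct1] Ck_on_sin_cos[THEN conjunct2] th Ck_on_coordinate;
        use rho_bounds in simp)+
  then have "Ck_on k UNIV (X m l)" for k by (intro Ck_on_vec) auto
  then show "smooth_on U (X m l)" unfolding smooth_on_def using Ck_on_subset by blast
qed

lemma continuous_X: "continuous_on A (X m l)"
  using smooth_on_X[OF open_UNIV] unfolding smooth_on_def by (metis Ck_on.simps(1) continuous_on_subset subset_UNIV)

definition X_s :: "real^2 \<Rightarrow> real^4" where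
  "X_s p = (let s = p $ 1; t = p $ 2; d = amp * cos (2 * s); u = sqrt (1 - rho s); v = sqrt (rho s) in
     vector [- d / u * cos (theta m l s) - u * speed (rho s) * sin (theta m l s),
             - d / u * sin (theta m l s) + u * speed (rho s) * cos (theta m l s),
             d / v * cos t, d / v * sin t])"

definition X_t :: "real^2 \<Rightarrow> real^4" where
  "X_t p = vector [0, 0, - sqrt (rho (p $ 1)) * sin (p $ 2), sqrt (rho (p $ 1)) * cos (p $ 2)]"

lemma DERIV_radii:
  "((\<lambda>s. sqrt (1 - rho s)) has_real_derivative - (amp * cos (2 * s)) / sqrt (1 - rho s)) (at s)"
  "((\<lambda>s. sqrt (rho s)) has_real_derivative amp * cos (2 * s) / sqrt (rho s)) (at s)"
  using rho_bounds[of s] by (auto intro!: derivative_eq_intros DERIV_rho simp: field_simps)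

lemma X_has_derivative: "(X m l has_derivative (\<lambda>h. (h $ 1) *\<^sub>R X_s p + (h $ 2) *\<^sub>R X_t p)) (at p)"
proof -
  have prod: "((\<lambda>p::real^2. A (p $ 1) * B (p $ 2)) has_derivative (\<lambda>h. (h $ 1) * (A' * B (p $ 2)) + (h $ 2) * (A (p $ 1) * B'))) (at p)"
    if "(A has_real_derivative A') (at (p $ 1))" "(B has_real_derivative B') (at (p $ 2))" for A B A' B'
  proof -
    have 1: "((\<lambda>p::real^2. A (p $ 1)) has_derivative (\<lambda>h. (h $ 1) * A')) (at p)"
      by (rule DERIV_compose_FDERIV[OF that(1) bounded_linear_imp_has_derivative[OF bounded_linear_vec_nth]])
    have 2: "((\<lambda>p::real^2. B (p $ 2)) has_derivative (\<lambda>h. (h $ 2) * B')) (at p)"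
      by (rule DERIV_compose_FDERIV[OF that(2) bounded_linear_imp_has_derivative[OF bounded_linear_vec_nth]])
    show ?thesis using has_derivative_mult[OF 1 2] by (simp add: algebra_simps)
  qed
  note th = DERIV_theta[of "p $ 1"]
  have c1: "((\<lambda>s. sqrt (1 - rho s) * cos (theta m l s)) has_real_derivative X_s p $ 1) (at (p $ 1))"
    by (rule DERIV_cong[OF DERIV_mult[OF DERIV_radii(1)[of "p $ 1"] DERIV_chain2[OF DERIV_cos th]]])
      (simp add: X_s_def Let_def vector_4 algebra_simps)
  have c2: "((\<lambda>s. sqrt (1 - rho s) * sin (theta m l s)) has_real_derivative X_s p $ 2) (at (p $ 1))"
    by (rule DERIV_cong[OF DERIV_mult[OF DERIV_radii(1)[of "p $ 1"] DERIV_chain2[OF DERIV_sin th]]])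
      (simp add: X_s_def Let_def vector_4 algebra_simps)
  show ?thesis
  proof (rule has_derivative_vec_nth_I)
    fix j :: 4
    show "((\<lambda>p. X m l p $ j) has_derivative (\<lambda>h. ((h $ 1) *\<^sub>R X_s p + (h $ 2) *\<^sub>R X_t p) $ j)) (at p)"
      using exhaust_4[of j]
    proof (elim disjE)
      assume "j = 1"
      then show ?thesis using prod[OF c1 DERIV_const[of 1]] by (simp add: X_component X_t_def vector_4)
    next
      assume "j = 2"
      then show ?thesis using prod[OF c2 DERIV_const[of 1]] by (simp add: X_component X_t_def vector_4)
    next
      assume "j = 3"
      then show ?thesis using prod[OF DERIV_radii(2) DERIV_cos]
        by (simp add: X_component X_t_def X_s_def Let_def vector_4)
    next
      assume "j = 4"
      then show ?thesis using prod[OF DERIV_radii(2) DERIV_sin]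
        by (simp add: X_component X_t_def X_s_def Let_def vector_4)
    qed
  qed
qed

text \<open>The integrand of \<open>\<theta>\<close> is chosen so that the curve \<open>t = const\<close> has unit speed: the three
  contributions to its squared speed add up to \<open>1\<close> by the first integral of \<open>\<rho>\<close>.\<close>

lemma X_first_fundamental_form:
  "X_s p \<bullet> X_s p = 1" "X_s p \<bullet> X_t p = 0" "X_t p \<bullet> X_t p = rho (p $ 1)"
proof -
  define s where "s = p $ 1"
  define d where "d = amp * cos (2 * s)"
  have r: "0 < rho s" "rho s < 1" using rho_bounds by auto
  have cs: "(sin x)\<^sup>2 + (cos x)\<^sup>2 = 1" for x :: real by simp
  have "X_s p \<bullet> X_s p = (- d / sqrt (1 - rho s))\<^sup>2 + (sqrt (1 - rho s) * speed (rho s))\<^sup>2 + (d / sqrt (rho s))\<^sup>2"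
    using cs[of "theta m l s"] cs[of "p $ 2"]
    unfolding inner_vec_def sum_4 X_s_def Let_def vector_4 s_def[symmetric] d_def[symmetric] inner_real_def
    by algebra
  also have "(sqrt (1 - rho s) * speed (rho s))\<^sup>2 = (m + (1 - 2 * l) * rho s) / (rho s * (1 - rho s))"
    unfolding speed_def power_mult_distrib power_divide
    using r radicand_pos[of "rho s"] by (simp add: power2_eq_square)
  also have "(- d / sqrt (1 - rho s))\<^sup>2 + \<dots> + (d / sqrt (rho s))\<^sup>2 = d\<^sup>2 / (1 - rho s) + (m + (1 - 2 * l) * rho s) / (rho s * (1 - rho s)) + d\<^sup>2 / rho s"
    using r by (simp add: power_divide)
  also have "\<dots> = (d\<^sup>2 + (m + (1 - 2 * l) * rho s)) / (rho s * (1 - rho s))"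
  proof -
    have "A / v + B / (u * v) + A / u = (A * (u + v) + B) / (u * v)" if "u \<noteq> 0" "v \<noteq> 0" for A B u v :: real
      using that by (simp add: field_simps)
    from this[of "rho s" "1 - rho s"] show ?thesis using r by simp
  qed
  also have "d\<^sup>2 = 2 * l * rho s - (rho s)\<^sup>2 - m"
    using rho'_square[of s] unfolding d_def by (simp add: power_mult_distrib)
  also have "(\<dots> + (m + (1 - 2 * l) * rho s)) / (rho s * (1 - rho s)) = 1"
    using r by (simp add: field_simps power2_eq_square)
  finally show "X_s p \<bullet> X_s p = 1" .
  show "X_s p \<bullet> X_t p = 0" 
    unfolding inner_vec_def sum_4 X_s_def X_t_def Let_def vector_4 by simp
  have "X_t p \<bullet> X_t p = (sqrt (rho s))\<^sup>2"
    using cs[of "p $ 2"]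
    unfolding inner_vec_def sum_4 X_t_def Let_def vector_4 s_def[symmetric] inner_real_def
    by algebra
  then show "X_t p \<bullet> X_t p = rho (p $ 1)" using r by (simp add: s_def)
qed

lemma norm_dX: "norm ((h $ 1) *\<^sub>R X_s p + (h $ 2) *\<^sub>R X_t p) ^ 2 = (h $ 1)\<^sup>2 + rho (p $ 1) * (h $ 2)\<^sup>2"
  unfolding power2_norm_eq_inner
  by (simp add: inner_add_left inner_add_right X_first_fundamental_form inner_commute[of "X_t p" "X_s p"] power2_eq_square)

end

context closed_profile
begin

text \<open>The inverse of \<open>X\<close> near a point with polar angles \<open>a\<close> and \<open>b\<close>, defined on an open set of the
  ambient space and not only on the surface. Applied to a map into the surface, it therefore gives
  coordinates of that map that are visibly continuous or smooth.\<close>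

definition chart_inv :: "real \<Rightarrow> real \<Rightarrow> real^4 \<Rightarrow> real^2" where
  "chart_inv a b x = vector [theta_inv (polar_angle a (x $ 1) (x $ 2)), polar_angle b (x $ 3) (x $ 4)]"

definition chart_range :: "real \<Rightarrow> real \<Rightarrow> (real^4) set" where
  "chart_range a b = {x. 0 < x $ 1 * cos a + x $ 2 * sin a \<and> 0 < x $ 3 * cos b + x $ 4 * sin b}"

lemma open_chart_range: "open (chart_range a b)"
  unfolding chart_range_def by (intro open_Collect_conj open_Collect_less continuous_intros)

text \<open>The two angles recover the directions of the two planar parts of \<open>x\<close>. The radii are recovered as
  well because \<open>\<rho>\<close> is a function of the first angle.\<close>

lemma X_chart_inv:
  assumes x: "x \<in> range (X m l)" "x \<in> chart_range a b"
  shows "X m l (chart_inv a b x) = x"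
proof -
  obtain p where p: "x = X m l p" using x by blast
  have pos: "0 < x $ 1 * cos a + x $ 2 * sin a" "0 < x $ 3 * cos b + x $ 4 * sin b"
    using x(2) by (auto simp: chart_range_def)
  define s where "s = theta_inv (polar_angle a (x $ 1) (x $ 2))"
  have r: "0 < sqrt (1 - rho (p $ 1))" using rho_bounds by simp
  have x12: "x $ 1 = sqrt (1 - rho (p $ 1)) * cos (theta m l s)"
    "x $ 2 = sqrt (1 - rho (p $ 1)) * sin (theta m l s)"
    using polar_angle_recover[OF pos(1)] unfolding s_def theta_inv by (simp_all add: p X_radii)
  have x34: "x $ 3 = sqrt (rho (p $ 1)) * cos (polar_angle b (x $ 3) (x $ 4))"
    "x $ 4 = sqrt (rho (p $ 1)) * sin (polar_angle b (x $ 3) (x $ 4))"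
    using polar_angle_recover[OF pos(2)] by (simp_all add: p X_radii)
  have "rho s = rho (p $ 1)"
  proof (rule rho_eq_of_theta)
    show "cos (theta m l s) = cos (theta m l (p $ 1))" "sin (theta m l s) = sin (theta m l (p $ 1))"
      using x12 r unfolding p X_component by auto
  qed
  moreover have "chart_inv a b x $ 1 = s" "chart_inv a b x $ 2 = polar_angle b (x $ 3) (x $ 4)"
    by (simp_all add: chart_inv_def s_def)
  ultimately show ?thesis
    unfolding vec_eq_iff_4 X_component using x12[symmetric] x34[symmetric] by simp
qed

definition chart_domain :: "real \<Rightarrow> real \<Rightarrow> (real^2) set" where
  "chart_domain a b = {p. \<bar>theta m l (p $ 1) - a\<bar> < pi / 2 \<and> \<bar>p $ 2 - b\<bar> < pi / 2}"

lemma open_chart_domain: "open (chart_domain a b)"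
proof -
  have "continuous_on UNIV (\<lambda>p::real^2. theta m l (p $ 1))"
    by (rule continuous_on_compose2[OF continuous_theta[of UNIV]]) (auto intro: continuous_intros)
  then show ?thesis
    unfolding chart_domain_def by (intro open_Collect_conj open_Collect_less continuous_intros)
qed

lemma chart_inv_X:
  assumes "p \<in> chart_domain a b"
  shows "X m l p \<in> chart_range a b" "chart_inv a b (X m l p) = p"
proof -
  have r: "0 < sqrt (1 - rho (p $ 1))" "0 < sqrt (rho (p $ 1))" using rho_bounds by simp_all
  have d: "\<bar>theta m l (p $ 1) - a\<bar> < pi / 2" "\<bar>p $ 2 - b\<bar> < pi / 2"
    using assms by (auto simp: chart_domain_def)
  note A = polar_angle_polar[OF r(1) d(1)] and B = polar_angle_polar[OF r(2) d(2)]
  show "X m l p \<in> chart_range a b" unfolding chart_range_def using A(1) B(1) by (simp add: X_component)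
  show "chart_inv a b (X m l p) = p" unfolding chart_inv_def X_component A(2) B(2) by (simp add: vec_eq_iff_2)
qed

lemma X_image_chart_domain: "X m l ` chart_domain a b = range (X m l) \<inter> chart_range a b"
proof (intro equalityI subsetI)
  fix x assume "x \<in> X m l ` chart_domain a b"
  then show "x \<in> range (X m l) \<inter> chart_range a b" using chart_inv_X(1) by auto
next
  fix x assume x: "x \<in> range (X m l) \<inter> chart_range a b"
  then have "X m l (chart_inv a b x) = x" using X_chart_inv by blast
  moreover have "chart_inv a b x \<in> chart_domain a b"
    unfolding chart_domain_def chart_inv_def using polar_angle_near by simp
  ultimately show "x \<in> X m l ` chart_domain a b" by (metis image_eqI)
qed

lemma continuous_chart_inv: "continuous_on (chart_range a b) (chart_inv a b)"
proof -
  have t: "continuous_on UNIV theta_inv"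
    by (simp add: continuous_at_imp_continuous_on isCont_theta_inv)
  have a: "continuous_on (chart_range a b) (\<lambda>x. polar_angle a (x $ 1) (x $ 2))"
    "continuous_on (chart_range a b) (\<lambda>x. polar_angle b (x $ 3) (x $ 4))"
    unfolding polar_angle_def chart_range_def by (intro continuous_intros; force)+
  have "continuous_on (chart_range a b) (\<lambda>x. \<chi> i::2. if i = 1 then theta_inv (polar_angle a (x $ 1) (x $ 2))
      else polar_angle b (x $ 3) (x $ 4))"
  proof (rule continuous_on_vec_lambda)
    fix i :: 2
    show "continuous_on (chart_range a b) (\<lambda>x. if i = 1 then theta_inv (polar_angle a (x $ 1) (x $ 2))
      else polar_angle b (x $ 3) (x $ 4))"
      using a continuous_on_compose2[OF t a(1)] by (cases "i = 1") auto
  qed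
  moreover have "chart_inv a b = (\<lambda>x. \<chi> i::2. if i = 1 then theta_inv (polar_angle a (x $ 1) (x $ 2))
      else polar_angle b (x $ 3) (x $ 4))"
    by (simp add: fun_eq_iff vec_eq_iff_2 chart_inv_def)
  ultimately show ?thesis by simp
qed

lemma local_parametrization_X: "local_parametrization (range (X m l)) (chart_domain a b) (X m l)"
  unfolding local_parametrization_def
proof (intro conjI ballI)
  show "open (chart_domain a b)" by (rule open_chart_domain)
  then show "smooth_on (chart_domain a b) (X m l)" by (rule smooth_on_X)
  show "openin (top_of_set (range (X m l))) (X m l ` chart_domain a b)"
    unfolding X_image_chart_domain by (rule openin_open_Int[OF open_chart_range])
  have "homeomorphism (chart_domain a b) (X m l ` chart_domain a b) (X m l) (chart_inv a b)"
  proof (rule homeomorphismI)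
    show "continuous_on (X m l ` chart_domain a b) (chart_inv a b)"
      by (rule continuous_on_subset[OF continuous_chart_inv]) (use chart_inv_X(1) in auto)
    show "chart_inv a b ` X m l ` chart_domain a b \<subseteq> chart_domain a b"
      using chart_inv_X(2) by (auto simp: image_iff)
    show "X m l (chart_inv a b y) = y" if "y \<in> X m l ` chart_domain a b" for y
      using that chart_inv_X(2) by auto
  qed (use chart_inv_X(2) continuous_X in auto)
  then show "\<exists>\<psi>. homeomorphism (chart_domain a b) (X m l ` chart_domain a b) (X m l) \<psi>" by blast
  fix p
  have D: "frechet_derivative (X m l) (at p) = (\<lambda>h. (h $ 1) *\<^sub>R X_s p + (h $ 2) *\<^sub>R X_t p)"
    using frechet_derivative_at[OF X_has_derivative] by simp
  have lin: "linear (frechet_derivative (X m l) (at p))"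
    unfolding D using X_has_derivative has_derivative_linear by blast
  show "inj (frechet_derivative (X m l) (at p))"
    unfolding linear_injective_0[OF lin] unfolding D
  proof (intro allI impI)
    fix h :: "real^2" assume "(h $ 1) *\<^sub>R X_s p + (h $ 2) *\<^sub>R X_t p = 0"
    then have "(h $ 1)\<^sup>2 + rho (p $ 1) * (h $ 2)\<^sup>2 = 0" unfolding norm_dX[symmetric] by simp
    moreover have "0 \<le> rho (p $ 1) * (h $ 2)\<^sup>2" "0 < rho (p $ 1)" using rho_bounds[of "p $ 1"] by simp_all
    ultimately show "h = 0" by (auto simp: vec_eq_iff_2 add_nonneg_eq_0_iff)
  qed
qed

lemma embedded_surface_X: "embedded_surface (range (X m l))"
  unfolding embedded_surface_def
proof
  fix x assume "x \<in> range (X m l)"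
  then obtain p where p: "x = X m l p" by blast
  have "p \<in> chart_domain (theta m l (p $ 1)) (p $ 2)" by (simp add: chart_domain_def)
  then show "\<exists>U \<phi>. local_parametrization (range (X m l)) U \<phi> \<and> x \<in> \<phi> ` U"
    using local_parametrization_X p by blast
qed

text \<open>\<open>X\<close> is periodic, so its range is the image of one closed period rectangle.\<close>

lemma compact_range_X: "compact (range (X m l))"
proof -
  let ?B = "cbox (vector [0, 0]) (vector [pi, 2 * pi]) :: (real^2) set"
  have "range (X m l) \<subseteq> X m l ` ?B"
  proof
    fix x assume "x \<in> range (X m l)"
    then obtain p where p: "x = X m l p" by blast
    define n where "n = \<lfloor>p $ 1 / pi\<rfloor>"
    define k where "k = \<lfloor>p $ 2 / (2 * pi)\<rfloor>"
    have "of_int n \<le> p $ 1 / pi" "p $ 1 / pi \<le> of_int n + 1" "of_int k \<le> p $ 2 / (2 * pi)" "p $ 2 / (2 * pi) \<le> of_int k + 1"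
      unfolding n_def k_def by linarith+
    then have nk: "of_int n * pi \<le> p $ 1" "p $ 1 \<le> of_int n * pi + pi"
      "of_int k * (2 * pi) \<le> p $ 2" "p $ 2 \<le> of_int k * (2 * pi) + 2 * pi"
      by (simp_all add: field_simps)
    define q :: "real^2" where "q = vector [p $ 1 - of_int n * pi, p $ 2 - of_int k * (2 * pi)]"
    have q: "p $ 1 = q $ 1 + of_int n * pi" "p $ 2 = q $ 2 + of_int k * (2 * pi)" by (simp_all add: q_def)
    have per: "cos (y + of_int j * (2 * pi)) = cos y" "sin (y + of_int j * (2 * pi)) = sin y" for y and j :: int
      using sin_cos_eq_iff[of "y + of_int j * (2 * pi)" y] by (auto simp: mult.commute)
    have th: "theta m l (q $ 1 + of_int n * pi) = theta m l (q $ 1) + of_int n * (2 * pi)"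
      unfolding theta_shift_int by simp
    have "X m l p = X m l q"
      unfolding vec_eq_iff_4 X_component q th rho_shift_int per by simp
    moreover have "q \<in> ?B" using nk by (simp add: mem_box_cart forall_2 q_def)
    ultimately show "x \<in> X m l ` ?B" using p by blast
  qed
  then have "range (X m l) = X m l ` ?B" by blast
  then show ?thesis by (simp add: compact_continuous_image continuous_X)
qed

end

section \<open>The Ricci condition in all parametrizations\<close>

lemma riemannian_metric_induced:
  fixes \<phi> :: "real^2 \<Rightarrow> 'a::euclidean_space"
  assumes U: "open U" and \<phi>: "smooth_on U \<phi>" and inj: "\<And>p. p \<in> U \<Longrightarrow> inj (frechet_derivative \<phi> (at p))"
  shows "riemannian_metric_on U (induced_metric \<phi>)"
  unfolding riemannian_metric_on_def
proof (intro conjI ballI allI impI)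
  have "Ck_on k U (\<lambda>p. pd i \<phi> p \<bullet> pd j \<phi> p)" for i j k
    using smooth_on_pd[OF \<phi>] by (intro Ck_on_bilinear[OF U bounded_bilinear_inner]) (auto simp: smooth_on_def)
  then have "Ck_on k U (\<lambda>p. induced_metric \<phi> p)" for k
    by (intro Ck_on_vec[OF U]) (simp add: induced_metric_def)
  then show "smooth_on U (induced_metric \<phi>)" by (simp add: smooth_on_def)
  fix p assume p: "p \<in> U"
  show "transpose (induced_metric \<phi> p) = induced_metric \<phi> p"
    by (simp add: transpose_def induced_metric_def vec_eq_iff inner_commute)
  fix v :: "real^2" assume v: "v \<noteq> 0"
  have D: "(\<phi> has_derivative (\<lambda>v. \<Sum>i\<in>UNIV. (v $ i) *\<^sub>R pd i \<phi> p)) (at p)"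
    by (rule has_derivative_pd[OF smooth_on_differentiable[OF \<phi> p]])
  then have "inj (\<lambda>v. \<Sum>i\<in>UNIV. (v $ i) *\<^sub>R pd i \<phi> p)"
    using inj[OF p] frechet_derivative_at[OF D] by simp
  moreover have "linear (\<lambda>v. \<Sum>i\<in>UNIV. (v $ i) *\<^sub>R pd i \<phi> p)" using D has_derivative_linear by blast
  ultimately have "(\<Sum>i\<in>UNIV. (v $ i) *\<^sub>R pd i \<phi> p) \<noteq> 0" using v linear_injective_0 by blast
  moreover have "v \<bullet> (induced_metric \<phi> p *v v) =
      (\<Sum>i\<in>UNIV. (v $ i) *\<^sub>R pd i \<phi> p) \<bullet> (\<Sum>i\<in>UNIV. (v $ i) *\<^sub>R pd i \<phi> p)"
    by (simp add: sum_2 inner_vec_def matrix_vector_mult_def induced_metric_def inner_add_left inner_add_right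
        algebra_simps)
  ultimately show "0 < v \<bullet> (induced_metric \<phi> p *v v)" by simp
qed

context rotational_profile
begin

text \<open>The form that \<open>- f'' / f\<close> takes by the first integral of \<open>\<rho>\<close>, see \<open>gauss_eq_warped_curvature\<close>.\<close>

definition gauss :: "real \<Rightarrow> real" where "gauss x = 1 - m / (rho x)\<^sup>2"
definition gauss_slope :: "real \<Rightarrow> real" where "gauss_slope x = 2 * m * (2 * amp * cos (2 * x)) / (rho x)^3"

lemma DERIV_gauss: "(gauss has_real_derivative gauss_slope x) (at x)"
proof -
  have "((\<lambda>x. 1 - m / (rho x)\<^sup>2) has_real_derivative 2 * m * (2 * amp * cos (2 * x)) / (rho x)^3) (at x)"
    using rho_bounds[of x] by (auto intro!: derivative_eq_intros DERIV_rho simp: field_simps power2_eq_square power3_eq_cube)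
  then show ?thesis by (simp add: gauss_def[abs_def] gauss_slope_def)
qed

text \<open>This derivative divided by \<open>sqrt \<rho>\<close> is the Laplacian of the curvature; the factor \<open>sqrt \<rho>\<close> is
  kept in front so that it cancels.\<close>

lemma DERIV_flux:
  "((\<lambda>x. sqrt (rho x) * gauss_slope x) has_real_derivative
     sqrt (rho x) * (2 * m * (4 * (l - rho x) / (rho x)^3 - 5 / 2 * (2 * amp * cos (2 * x))\<^sup>2 / (rho x)^4))) (at x)"
proof -
  define d where "d = (\<lambda>x. 2 * amp * cos (2 * x))"
  have d: "(d has_real_derivative 4 * (l - rho x)) (at x)" "(rho has_real_derivative d x) (at x)"
    unfolding d_def by (rule DERIV_rho', rule DERIV_rho)
  have r: "0 < rho x" "rho x \<noteq> 0" using rho_bounds[of x] by auto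
  have 1: "((\<lambda>x. 2 * m * d x / (rho x)^3) has_real_derivative
     2 * m * (4 * (l - rho x) / (rho x)^3 - 3 * (d x)\<^sup>2 / (rho x)^4)) (at x)"
    using r by (auto intro!: derivative_eq_intros d simp: field_simps power2_eq_square power3_eq_cube power4_eq_xxxx)
  have 2: "((\<lambda>x. sqrt (rho x)) has_real_derivative sqrt (rho x) * (d x / (2 * rho x))) (at x)"
  proof -
    have "inverse (sqrt (rho x)) / 2 * d x = sqrt (rho x) * (d x / (2 * rho x))"
      using r by (simp add: field_simps)
    then show ?thesis by (rule DERIV_cong[OF DERIV_chain2[OF DERIV_real_sqrt[OF r(1)] d(2)]])
  qed
  have "((\<lambda>x. sqrt (rho x) * (2 * m * d x / (rho x)^3)) has_real_derivative
     sqrt (rho x) * (2 * m * (4 * (l - rho x) / (rho x)^3 - 5 / 2 * (d x)\<^sup>2 / (rho x)^4))) (at x)"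
  proof (rule DERIV_cong[OF DERIV_mult[OF 2 1]])
    have "sqrt (rho x) * (d x / (2 * rho x)) * (2 * m * d x / (rho x)^3) + 2 * m * (4 * (l - rho x) / (rho x)^3 - 3 * (d x)\<^sup>2 / (rho x)^4) * sqrt (rho x)
       = sqrt (rho x) * ((d x / (2 * rho x)) * (2 * m * d x / (rho x)^3) + 2 * m * (4 * (l - rho x) / (rho x)^3 - 3 * (d x)\<^sup>2 / (rho x)^4))"
      by (simp add: algebra_simps)
    also have "(d x / (2 * rho x)) * (2 * m * d x / (rho x)^3) + 2 * m * (4 * (l - rho x) / (rho x)^3 - 3 * (d x)\<^sup>2 / (rho x)^4)
       = 2 * m * (4 * (l - rho x) / (rho x)^3 - 5 / 2 * (d x)\<^sup>2 / (rho x)^4)"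
      using r(2) by (simp add: field_simps power2_eq_square power3_eq_cube power4_eq_xxxx)
    finally show "sqrt (rho x) * (d x / (2 * rho x)) * (2 * m * d x / (rho x)^3) + 2 * m * (4 * (l - rho x) / (rho x)^3 - 3 * (d x)\<^sup>2 / (rho x)^4) * sqrt (rho x)
       = sqrt (rho x) * (2 * m * (4 * (l - rho x) / (rho x)^3 - 5 / 2 * (d x)\<^sup>2 / (rho x)^4))" .
  qed
  then show ?thesis by (simp add: gauss_slope_def d_def)
qed

lemma gauss_eq_warped_curvature:
  "(2 * amp * cos (2 * x))\<^sup>2 / (4 * (rho x)\<^sup>2) - 4 * (l - rho x) / (2 * rho x) = gauss x"
  using rho_bounds[of x] unfolding rho'_square gauss_def by (simp add: field_simps power2_eq_square)

text \<open>With \<open>r\<close>, \<open>d\<close>, \<open>e\<close> for \<open>\<rho>\<close>, \<open>\<rho>'\<close>, \<open>\<rho>''\<close>, the identity is algebraic in \<open>r\<close>, \<open>d\<close>, \<open>e\<close> once the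
  factor \<open>K\<close> is written as \<open>d\<^sup>2 / (4 r\<^sup>2) - e / (2 r)\<close> and \<open>K - 1\<close> as \<open>- m / r\<^sup>2\<close>.\<close>

lemma ricci_identity:
  "(gauss x - 1) * (2 * m * (4 * (l - rho x) / (rho x)^3 - 5 / 2 * (2 * amp * cos (2 * x))\<^sup>2 / (rho x)^4))
    - (gauss_slope x)\<^sup>2 - 4 * gauss x * (gauss x - 1)\<^sup>2 = 0"
proof -
  define r d e where "r = rho x" and "d = 2 * amp * cos (2 * x)" and "e = 4 * (l - r)"
  have r: "r \<noteq> 0" using rho_bounds[of x] by (simp add: r_def)
  have K: "gauss x = d\<^sup>2 / (4 * r\<^sup>2) - e / (2 * r)" unfolding r_def d_def e_def by (rule gauss_eq_warped_curvature[symmetric])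
  have K1: "gauss x - 1 = - m / r\<^sup>2" by (simp add: gauss_def r_def)
  have K': "gauss_slope x = 2 * m * d / r^3" by (simp add: gauss_slope_def r_def d_def)
  have "- m / r\<^sup>2 * (2 * m * (e / r^3 - 5 / 2 * d\<^sup>2 / r^4)) - (2 * m * d / r^3)\<^sup>2
      - 4 * (d\<^sup>2 / (4 * r\<^sup>2) - e / (2 * r)) * (- m / r\<^sup>2)\<^sup>2 = 0"
    using r by (simp add: field_simps power2_eq_square power3_eq_cube power4_eq_xxxx)
  then show ?thesis unfolding K1 K' unfolding K unfolding r_def[symmetric] d_def[symmetric] e_def[symmetric] .
qed

lemma spherical_ricci_warped:
  assumes "warped_coordinates W s t rho (\<lambda>x. 2 * amp * cos (2 * x)) (\<lambda>x. 4 * (l - rho x)) g" and q: "q \<in> W"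
  shows "(gauss_curvature g q - 1) * laplace_beltrami g (gauss_curvature g) q
    - metric_norm_sq g q (gradient g (gauss_curvature g) q) - 4 * gauss_curvature g q * (gauss_curvature g q - 1)\<^sup>2 = 0"
proof -
  interpret W: warped_coordinates W s t rho "\<lambda>x. 2 * amp * cos (2 * x)" "\<lambda>x. 4 * (l - rho x)" g by fact
  have K: "gauss_curvature g p = gauss (s p)" if "p \<in> W" for p
    using W.gauss_curvature_warped[OF that] unfolding W.warped_curvature_def gauss_eq_warped_curvature .
  have "metric_norm_sq g q (gradient g (gauss_curvature g) q) = (gauss_slope (s q))\<^sup>2"
    by (rule W.norm_gradient_radial[OF K DERIV_gauss q])
  moreover have "laplace_beltrami g (gauss_curvature g) q = sqrt (rho (s q)) * (2 * m * (4 * (l - rho (s q)) / (rho (s q))^3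
       - 5 / 2 * (2 * amp * cos (2 * s q))\<^sup>2 / (rho (s q))^4)) / sqrt (rho (s q))"
    by (rule W.laplace_beltrami_radial[OF K DERIV_gauss q DERIV_flux])
  moreover have "sqrt (rho (s q)) \<noteq> 0" using rho_bounds[of "s q"] by simp
  ultimately show ?thesis using ricci_identity[of "s q"] K[OF q] by simp
qed

text \<open>The chain rule and the orthogonality of \<open>X_s\<close> and \<open>X_t\<close> give the form of the metric. If the
  Jacobian of \<open>(s, t)\<close> vanished, the metric would be degenerate, contrary to \<open>\<phi>\<close> being an immersion.\<close>

lemma warped_coordinates_of_factorization:
  assumes W: "open W" and \<phi>: "smooth_on W \<phi>" and inj: "\<And>p. p \<in> W \<Longrightarrow> inj (frechet_derivative \<phi> (at p))"
    and s: "smooth_on W s" and t: "smooth_on W t"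
    and eq: "\<And>q. q \<in> W \<Longrightarrow> \<phi> q = X m l (vector [s q, t q])"
  shows "warped_coordinates W s t rho (\<lambda>x. 2 * amp * cos (2 * x)) (\<lambda>x. 4 * (l - rho x)) (induced_metric \<phi>)"
proof -
  have D: "(\<phi> has_derivative (\<lambda>h. (\<Sum>i\<in>UNIV. h $ i *\<^sub>R pd i s q) *\<^sub>R X_s (vector [s q, t q])
      + (\<Sum>i\<in>UNIV. h $ i *\<^sub>R pd i t q) *\<^sub>R X_t (vector [s q, t q]))) (at q)" if q: "q \<in> W" for q
  proof -
    have ds: "(s has_derivative (\<lambda>h. \<Sum>i\<in>UNIV. h $ i *\<^sub>R pd i s q)) (at q)"
      by (rule has_derivative_pd[OF smooth_on_differentiable[OF s q]])
    have dt: "(t has_derivative (\<lambda>h. \<Sum>i\<in>UNIV. h $ i *\<^sub>R pd i t q)) (at q)"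
      by (rule has_derivative_pd[OF smooth_on_differentiable[OF t q]])
    have dh: "((\<lambda>q. vector [s q, t q] :: real^2) has_derivative
        (\<lambda>h. vector [\<Sum>i\<in>UNIV. h $ i *\<^sub>R pd i s q, \<Sum>i\<in>UNIV. h $ i *\<^sub>R pd i t q])) (at q)"
    proof (rule has_derivative_vec_nth_I)
      fix j :: 2
      show "((\<lambda>q. (vector [s q, t q] :: real^2) $ j) has_derivative
        (\<lambda>h. (vector [\<Sum>i\<in>UNIV. h $ i *\<^sub>R pd i s q, \<Sum>i\<in>UNIV. h $ i *\<^sub>R pd i t q] :: real^2) $ j)) (at q)"
        using exhaust_2[of j] ds dt by auto
    qed
    from has_derivative_compose[OF dh X_has_derivative]
    have "((\<lambda>q. X m l (vector [s q, t q])) has_derivative (\<lambda>h. (\<Sum>i\<in>UNIV. h $ i *\<^sub>R pd i s q) *\<^sub>R X_s (vector [s q, t q])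
      + (\<Sum>i\<in>UNIV. h $ i *\<^sub>R pd i t q) *\<^sub>R X_t (vector [s q, t q]))) (at q)" by simp
    moreover have "(\<phi> has_derivative D) (at q) \<longleftrightarrow> ((\<lambda>q. X m l (vector [s q, t q])) has_derivative D) (at q)" for D
      by (rule has_derivative_cong_open[OF W q]) (rule eq)
    ultimately show ?thesis by blast
  qed
  have pd: "pd i \<phi> q = pd i s q *\<^sub>R X_s (vector [s q, t q]) + pd i t q *\<^sub>R X_t (vector [s q, t q])" if "q \<in> W" for i q
    using pd_eqI[OF D[OF that], of i] exhaust_2[of i] by (auto simp: sum_2 axis_def)
  have g: "induced_metric \<phi> q = (\<chi> i j. pd i s q * pd j s q + rho (s q) * (pd i t q * pd j t q))" if "q \<in> W" for q
    unfolding induced_metric_def pd[OF that]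
    by (simp add: vec_eq_iff inner_add_left inner_add_right X_first_fundamental_form
        inner_commute[of "X_t (vector [s q, t q])" "X_s (vector [s q, t q])"])
  have jac: "pd 1 s q * pd 2 t q - pd 2 s q * pd 1 t q \<noteq> 0" if q: "q \<in> W" for q
  proof
    assume 0: "pd 1 s q * pd 2 t q - pd 2 s q * pd 1 t q = 0"
    have "riemannian_metric_on W (induced_metric \<phi>)" by (rule riemannian_metric_induced[OF W \<phi> inj])
    then have pos: "0 < v \<bullet> (induced_metric \<phi> q *v v)" if "v \<noteq> 0" for v
      using q that unfolding riemannian_metric_on_def by blast
    have form: "v \<bullet> (induced_metric \<phi> q *v v) = (v $ 1 * pd 1 s q + v $ 2 * pd 2 s q)\<^sup>2
      + rho (s q) * (v $ 1 * pd 1 t q + v $ 2 * pd 2 t q)\<^sup>2" for v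
      by (simp add: inner_vec_def matrix_vector_mult_def sum_2 g[OF q] power2_eq_square algebra_simps)
    (* The vectors annihilated by ds and by dt have length zero, so ds and dt vanish. *)
    have a: "vector [- pd 2 s q, pd 1 s q] = (0 :: real^2)"
    proof (rule ccontr)
      assume "vector [- pd 2 s q, pd 1 s q] \<noteq> (0 :: real^2)"
      from pos[OF this] show False using 0 unfolding form by (simp add: algebra_simps)
    qed
    have b: "vector [- pd 2 t q, pd 1 t q] = (0 :: real^2)"
    proof (rule ccontr)
      assume "vector [- pd 2 t q, pd 1 t q] \<noteq> (0 :: real^2)"
      from pos[OF this] show False using 0 unfolding form by (simp add: algebra_simps)
    qed
    have "axis 1 1 \<noteq> (0 :: real^2)" by (simp add: axis_eq_0_iff)
    from pos[OF this] show False unfolding form using a b by (simp add: vec_eq_iff_2 axis_def)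
  qed
  show ?thesis
    by unfold_locales (use W s t DERIV_rho DERIV_rho' rho_bounds(1) g jac in auto)
qed

end

context closed_profile
begin

text \<open>Composing \<open>\<phi>\<close> with the ambient inverse of a chart of \<open>X\<close>. The smoothness of \<open>s\<close> is read off
  from its differential: \<open>s\<^sub>i = \<alpha>\<^sub>i / \<theta>'(s)\<close>, and \<open>\<theta>'(s)\<close> is a smooth function of
  \<open>\<rho>(s) = \<phi>\<^sub>3\<^sup>2 + \<phi>\<^sub>4\<^sup>2\<close>.\<close>

lemma local_factorization:
  assumes U: "open U" and \<phi>: "smooth_on U \<phi>" and im: "\<phi> ` U \<subseteq> range (X m l)" and p: "p \<in> U"
  obtains W s t where "open W" "p \<in> W" "W \<subseteq> U" "smooth_on W s" "smooth_on W t"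
    "\<And>q. q \<in> W \<Longrightarrow> \<phi> q = X m l (vector [s q, t q])"
proof -
  obtain p0 where p0: "\<phi> p = X m l p0" using im p by blast
  define a b where "a = theta m l (p0 $ 1)" and "b = p0 $ 2"
  define W where "W = U \<inter> \<phi> -` chart_range a b"
  define s where "s q = theta_inv (polar_angle a (\<phi> q $ 1) (\<phi> q $ 2))" for q
  define t where "t q = polar_angle b (\<phi> q $ 3) (\<phi> q $ 4)" for q
  have "continuous_on U \<phi>" using \<phi> unfolding smooth_on_def by (metis Ck_on.simps(1))
  then have W: "open W" unfolding W_def by (rule continuous_open_preimage[OF _ U open_chart_range])
  have "\<phi> p \<in> chart_range a b" unfolding p0 by (rule chart_inv_X) (simp add: chart_domain_def a_def b_def)
  then have pW: "p \<in> W" using p by (simp add: W_def)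
  have WU: "W \<subseteq> U" by (auto simp: W_def)
  have comp: "Ck_on k W (\<lambda>q. \<phi> q $ j)" for k j
    using smooth_on_component[OF W smooth_on_subset[OF \<phi> WU]] by (simp add: smooth_on_def)
  have eq: "\<phi> q = X m l (vector [s q, t q])" if "q \<in> W" for q
  proof -
    have "X m l (chart_inv a b (\<phi> q)) = \<phi> q"
      using that im by (intro X_chart_inv) (auto simp: W_def)
    then show ?thesis by (simp add: chart_inv_def s_def t_def)
  qed
  have t: "smooth_on W t"
    unfolding smooth_on_def t_def
    by (intro allI Ck_on_polar_angle[OF W] comp) (auto simp: W_def chart_range_def)
  define \<alpha> where "\<alpha> q = polar_angle a (\<phi> q $ 1) (\<phi> q $ 2)" for q
  have \<alpha>: "smooth_on W \<alpha>"
    unfolding smooth_on_def \<alpha>_def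
    by (intro allI Ck_on_polar_angle[OF W] comp) (auto simp: W_def chart_range_def)
  define u where "u q = \<phi> q $ 3 * \<phi> q $ 3 + \<phi> q $ 4 * \<phi> q $ 4" for q
  have u: "rho (s q) = u q" if "q \<in> W" for q
    unfolding u_def using X_radii(2)[of "vector [s q, t q]"] eq[OF that] by (simp add: power2_eq_square)
  have u01: "0 < u q" "u q < 1" if "q \<in> W" for q
    using rho_bounds[of "s q"] unfolding u[OF that] by auto
  have Cu: "Ck_on k W u" for k unfolding u_def by (intro Ck_on_add Ck_on_mult comp W)
  have s: "smooth_on W s"
  proof (rule smooth_on_I)
    have d: "pd i s q = 1 / speed (rho (s q)) * pd i \<alpha> q" "s differentiable (at q)" if "q \<in> W" for q i
      using pd_comp[OF DERIV_theta_inv smooth_on_differentiable[OF \<alpha> that]]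
      unfolding s_def \<alpha>_def by auto
    then show "s differentiable (at q)" if "q \<in> W" for q using that by blast
    fix i
    have "smooth_on W (\<lambda>q. sqrt (u q) * (1 - u q) * inverse (sqrt (m + (1 - 2 * l) * u q)) * pd i \<alpha> q)"
      unfolding smooth_on_def
      by (intro allI Ck_on_mult Ck_on_inverse Ck_on_sqrt Ck_on_add Ck_on_diff Ck_on_const Cu W)
        (use u01 radicand_pos smooth_on_pd[OF \<alpha>, of i] in \<open>auto simp: less_le smooth_on_def\<close>)
    then show "smooth_on W (pd i s)"
    proof (rule smooth_on_cong[OF W, rotated])
      show "sqrt (u q) * (1 - u q) * inverse (sqrt (m + (1 - 2 * l) * u q)) * pd i \<alpha> q = pd i s q" if "q \<in> W" for q
        unfolding d(1)[OF that] u[OF that] speed_def by (simp add: divide_inverse)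
    qed
  qed
  show ?thesis by (rule that[OF W pW WU s t eq])
qed

lemma spherical_ricci_surface_X: "spherical_ricci_surface (range (X m l))"
  unfolding spherical_ricci_surface_def
proof (intro conjI allI impI)
  show "embedded_surface (range (X m l))" by (rule embedded_surface_X)
  fix U \<phi> assume lp: "local_parametrization (range (X m l)) U \<phi>"
  then have U: "open U" and \<phi>: "smooth_on U \<phi>" and inj: "\<And>p. p \<in> U \<Longrightarrow> inj (frechet_derivative \<phi> (at p))"
    and im: "\<phi> ` U \<subseteq> range (X m l)"
    unfolding local_parametrization_def openin_subtopology by auto
  show "spherical_ricci_metric_on U (induced_metric \<phi>)"
    unfolding spherical_ricci_metric_on_def Let_def
  proof (intro conjI ballI)
    show "riemannian_metric_on U (induced_metric \<phi>)" by (rule riemannian_metric_induced[OF U \<phi> inj])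
    fix p assume "p \<in> U"
    then obtain W s t where W: "open W" "p \<in> W" "W \<subseteq> U" "smooth_on W s" "smooth_on W t"
      "\<And>q. q \<in> W \<Longrightarrow> \<phi> q = X m l (vector [s q, t q])"
      using local_factorization[OF U \<phi> im] by blast
    have "warped_coordinates W s t rho (\<lambda>x. 2 * amp * cos (2 * x)) (\<lambda>x. 4 * (l - rho x)) (induced_metric \<phi>)"
      using inj W(3) by (intro warped_coordinates_of_factorization W smooth_on_subset[OF \<phi> W(3)]) auto
    from spherical_ricci_warped[OF this W(2)]
    show "(gauss_curvature (induced_metric \<phi>) p - 1) * laplace_beltrami (induced_metric \<phi>) (gauss_curvature (induced_metric \<phi>)) p
      - metric_norm_sq (induced_metric \<phi>) p (gradient (induced_metric \<phi>) (gauss_curvature (induced_metric \<phi>)) p)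
      - 4 * gauss_curvature (induced_metric \<phi>) p * (gauss_curvature (induced_metric \<phi>) p - 1)\<^sup>2 = 0" .
  qed
qed

end

theorem theorem5p6:
  fixes m :: real
  assumes "m \<in> {0<..<9/16}"
  shows "(\<exists>l\<in>{1/2<..<25/32}. (m, l) \<in> Lambda1' \<and> Theta m l = 2 * pi) \<and>
    (\<forall>l\<in>{1/2<..<25/32}. (m, l) \<in> Lambda1' \<and> Theta m l = 2 * pi \<longrightarrow>
       range (X m l) \<subseteq> sphere 0 1 \<and> compact (range (X m l)) \<and>
       embedded_surface (range (X m l)) \<and> spherical_ricci_surface (range (X m l)))"
proof (intro conjI ballI impI)
  obtain l where l: "1/2 < l" "sqrt m < l" "l < (m + 1) / 2" "Theta m l = 2 * pi"
    using exists_closing_parameter[of m] assms by auto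
  then have "l < 25/32" using assms by simp
  then show "\<exists>l\<in>{1/2<..<25/32}. (m, l) \<in> Lambda1' \<and> Theta m l = 2 * pi"
    using l assms by (intro bexI[of _ l]) (auto simp: Lambda1'_def)
next
  fix l assume l: "l \<in> {1/2<..<25/32}" "(m, l) \<in> Lambda1' \<and> Theta m l = 2 * pi"
  then interpret closed_profile m l by unfold_locales (auto simp: Lambda1'_def)
  show "range (X m l) \<subseteq> sphere 0 1" using X_in_sphere by blast
  show "compact (range (X m l))" by (rule compact_range_X)
  show "embedded_surface (range (X m l))" by (rule embedded_surface_X)
  show "spherical_ricci_surface (range (X m l))" by (rule spherical_ricci_surface_X)
qed

end
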